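(* For $n\in\mathbb N$ let $\mathcal Z_n$ be the unique element of the center of $\mathcal O_q$ such that $\varphi(\mathcal Z_n)=1\otimes z_n$, and let $\mathcal Z(t)=\sum_{n\in\mathbb N}\mathcal Z_nt^n$. Then $$\mathcal Z^\vee(t)=\mathcal Z(S)\,\mathcal Z(T),$$ where $S=\dfrac{q+q^{-1}}{q^{-1}t+qt^{-1}}$ and $T=\dfrac{q+q^{-1}}{qt+q^{-1}t^{-1}}$.
   Context: $\mathbb F$ is a field; $q\in\mathbb F$ is nonzero and not a root of unity; $\mathbb N=\{0,1,2,\ldots\}$; $[n]_q=(q^n-q^{-n})/(q-q^{-1})$. Algebras are associative, unital, over $\mathbb F$. $[X,Y]=XY-YX$ and $[X,Y]_r=rXY-r^{-1}YX$ for nonzero $r \in \mathbb F$. $\mathbb F[z_1,z_2,\ldots]$ is the polynomial algebra in countably many commuting variables, with $z_0=1$. The $q$-Onsager algebra $O_q$ has generators $W_0,W_1$ and relations $[W_0,[W_0,[W_0,W_1]_q]_{q^{-1}}]=(q^2-q^{-2})^2[W_1,W_0]$ and $[W_1,[W_1,[W_1,W_0]_q]_{q^{-1}}]=(q^2-q^{-2})^2[W_0,W_1]$. The algebra $\mathcal O_q$ has generators $\mathcal W_{-k},\mathcal W_{k+1},\mathcal G_{k+1},\mathcal{\tilde G}_{k+1}$ ($k\in\mathbb N$) and the following relations for $k,\ell\in\mathbb N$, where $\rho=-(q^2-q^{-2})^2$: $[\mathcal W_0,\mathcal W_{k+1}]=[\mathcal W_{-k},\mathcal W_1]=(\mathcal{\tilde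 G}_{k+1}-\mathcal G_{k+1})/(q+q^{-1})$; $[\mathcal W_0,\mathcal G_{k+1}]_q=[\mathcal{\tilde G}_{k+1},\mathcal W_0]_q=\rho\mathcal W_{-k-1}-\rho\mathcal W_{k+1}$; $[\mathcal G_{k+1},\mathcal W_1]_q=[\mathcal W_1,\mathcal{\tilde G}_{k+1}]_q=\rho\mathcal W_{k+2}-\rho\mathcal W_{-k}$; $[\mathcal W_{-k},\mathcal W_{-\ell}]=0$; $[\mathcal W_{k+1},\mathcal W_{\ell+1}]=0$; $[\mathcal W_{-k},\mathcal W_{\ell+1}]+[\mathcal W_{k+1},\mathcal W_{-\ell}]=0$; $[\mathcal W_{-k},\mathcal G_{\ell+1}]+[\mathcal G_{k+1},\mathcal W_{-\ell}]=0$; $[\mathcal W_{-k},\mathcal{\tilde G}_{\ell+1}]+[\mathcal{\tilde G}_{k+1},\mathcal W_{-\ell}]=0$; $[\mathcal W_{k+1},\mathcal G_{\ell+1}]+[\mathcal G_{k+1},\mathcal W_{\ell+1}]=0$; $[\mathcal W_{k+1},\mathcal{\tilde G}_{\ell+1}]+[\mathcal{\tilde G}_{k+1},\mathcal W_{\ell+1}]=0$; $[\mathcal G_{k+1},\mathcal G_{\ell+1}]=0$; $[\mathcal{\tilde G}_{k+1},\mathcal{\tilde G}_{\ell+1}]=0$; $[\mathcal{\tilde G}_{k+1},\mathcal G_{\ell+1}]+[\mathcal G_{k+1},\mathcal{\tilde G}_{\ell+1}]=0$. Also $\mathcal G_0=\mathcal{\tilde G}_0=-(q-q^{-1})[2]_q^2$.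 Set $\mathcal W^-(t)=\sum_{n\in\mathbb N}\mathcal W_{-n}t^n$, $\mathcal W^+(t)=\sum_{n\in\mathbb N}\mathcal W_{n+1}t^n$, $\mathcal G(t)=\sum_{n\in\mathbb N}\mathcal G_nt^n$, $\mathcal{\tilde G}(t)=\sum_{n\in\mathbb N}\mathcal{\tilde G}_nt^n$. $S$ and $T$ are viewed as power series $S=(q+q^{-1})\sum_{\ell\in\mathbb N}(-1)^\ell q^{-2\ell-1}t^{2\ell+1}$, $T=(q+q^{-1})\sum_{\ell\in\mathbb N}(-1)^\ell q^{2\ell+1}t^{2\ell+1}$. Define $\Psi(t)=t^{-1}ST\,\mathcal W^-(S)\mathcal W^+(T)+tST\,\mathcal W^+(S)\mathcal W^-(T)-q^2ST\,\mathcal W^-(S)\mathcal W^-(T)-q^{-2}ST\,\mathcal W^+(S)\mathcal W^+(T)+(q^2-q^{-2})^{-2}\mathcal G(S)\mathcal{\tilde G}(T)$ and $\sum_{n\in\mathbb N}\mathcal Z^\vee_nt^n=\mathcal Z^\vee(t)=[2]_q^{-2}\Psi(t)$; one has $\mathcal Z^\vee_0=1$ and each $\mathcal Z^\vee_n$ is central in $\mathcal O_q$. Known from earlier work: there is an algebra isomorphism $\phi:O_q\otimes\mathbb F[z_1,z_2,\ldots]\to\mathcal O_q$ that sends $W_0\otimes1\mapsto\mathcal W_0$, $W_1\otimes1\mapsto\mathcal W_1$, $1\otimes z_n\mapsto\mathcal Z^\vee_n$ ($n\ge1$). Consequently there is an algebra homomorphism $\gamma:\mathcal O_q\to O_q$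 that sends $\mathcal W_0\mapsto W_0$, $\mathcal W_1\mapsto W_1$, $\mathcal Z^\vee_n\mapsto0$ ($n\ge1$). Set $W_{-k}=\gamma(\mathcal W_{-k})$, $W_{k+1}=\gamma(\mathcal W_{k+1})$, $G_{k+1}=\gamma(\mathcal G_{k+1})$, $\tilde G_{k+1}=\gamma(\mathcal{\tilde G}_{k+1})$ for $k\in\mathbb N$, and $G_0=\tilde G_0=-(q-q^{-1})[2]_q^2$. $\varphi:\mathcal O_q\to O_q\otimes\mathbb F[z_1,z_2,\ldots]$ is the algebra isomorphism that sends $\mathcal W_{-n}\mapsto\sum_{k=0}^nW_{k-n}\otimes z_k$, $\mathcal W_{n+1}\mapsto\sum_{k=0}^nW_{n+1-k}\otimes z_k$, $\mathcal G_n\mapsto\sum_{k=0}^nG_{n-k}\otimes z_k$, $\mathcal{\tilde G}_n\mapsto\sum_{k=0}^n\tilde G_{n-k}\otimes z_k$ for $n\in\mathbb N$. It maps the center of $\mathcal O_q$ onto $1\otimes\mathbb F[z_1,z_2,\ldots]$. *)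

theory Defs
  imports
    "HOL-Library.Poly_Mapping"
    "HOL-Library.Multiset"
    "HOL-Computational_Algebra.Formal_Laurent_Series"
    "HOL-Algebra.QuotRing"
    "HOL-Algebra.Module"
begin

section \<open>Associative unital algebras over a field\<close>

text \<open>
  An algebra over the field \<open>'f\<close> is represented by a \<^typ>\<open>('f, 'a) module\<close> record: the ring
  operations together with a scalar multiplication. (The library locale \<open>algebra\<close> is of no use
  here, since it requires the ring to be commutative.)
\<close>

definition alg_hom :: "('f::field, 'a) module \<Rightarrow> ('f, 'b) module \<Rightarrow> ('a \<Rightarrow> 'b) set" where
  "alg_hom A B =
     {h \<in> ring_hom A B. \<forall>c. \<forall>x \<in> carrier A. h (c \<odot>\<^bsub>A\<^esub> x) = c \<odot>\<^bsub>B\<^esub> h x}"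

definition alg_iso :: "('f::field, 'a) module \<Rightarrow> ('f, 'b) module \<Rightarrow> ('a \<Rightarrow> 'b) set" where
  "alg_iso A B = {h \<in> alg_hom A B. bij_betw h (carrier A) (carrier B)}"

definition center :: "('f::field, 'a) module \<Rightarrow> 'a set" where
  "center A = {z \<in> carrier A. \<forall>x \<in> carrier A. z \<otimes>\<^bsub>A\<^esub> x = x \<otimes>\<^bsub>A\<^esub> z}"

definition commutator :: "('f::field, 'a) module \<Rightarrow> 'a \<Rightarrow> 'a \<Rightarrow> 'a" where
  "commutator A X Y = X \<otimes>\<^bsub>A\<^esub> Y \<ominus>\<^bsub>A\<^esub> Y \<otimes>\<^bsub>A\<^esub> X"

definition rcommutator :: "('f::field, 'a) module \<Rightarrow> 'f \<Rightarrow> 'a \<Rightarrow> 'a \<Rightarrow> 'a" where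
  "rcommutator A r X Y =
     (r \<odot>\<^bsub>A\<^esub> (X \<otimes>\<^bsub>A\<^esub> Y)) \<ominus>\<^bsub>A\<^esub> (inverse r \<odot>\<^bsub>A\<^esub> (Y \<otimes>\<^bsub>A\<^esub> X))"


subsection \<open>Monoid algebras\<close>

definition monoid_algebra :: "('m, 'r) monoid_scheme \<Rightarrow> ('f::field, 'm \<Rightarrow>\<^sub>0 'f) module" where
  "monoid_algebra M =
     \<lparr>carrier = {p. Poly_Mapping.keys p \<subseteq> carrier M},
      mult = (\<lambda>p r. \<Sum>x \<in> Poly_Mapping.keys p. \<Sum>y \<in> Poly_Mapping.keys r.
                Poly_Mapping.single (x \<otimes>\<^bsub>M\<^esub> y)
                  (Poly_Mapping.lookup p x * Poly_Mapping.lookup r y)),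
      one = Poly_Mapping.single \<one>\<^bsub>M\<^esub> 1,
      zero = 0,
      add = (+),
      smult = (\<lambda>c p. Poly_Mapping.map (\<lambda>a. c * a) p)\<rparr>"

lemma monoid_algebra_mult_sum:
  fixes p r :: "'m \<Rightarrow>\<^sub>0 'f::field"
  assumes "finite X" "finite Y" "Poly_Mapping.keys p \<subseteq> X" "Poly_Mapping.keys r \<subseteq> Y"
  shows "p \<otimes>\<^bsub>monoid_algebra M\<^esub> r = (\<Sum>x\<in>X. \<Sum>y\<in>Y. Poly_Mapping.single (x \<otimes>\<^bsub>M\<^esub> y) (Poly_Mapping.lookup p x * Poly_Mapping.lookup r y))"
proof -
  have "p \<otimes>\<^bsub>monoid_algebra M\<^esub> r = (\<Sum>x\<in>Poly_Mapping.keys p. \<Sum>y\<in>Y. Poly_Mapping.single (x \<otimes>\<^bsub>M\<^esub> y) (Poly_Mapping.lookup p x * Poly_Mapping.lookup r y))"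
    unfolding monoid_algebra_def
    by (use assms in simp, rule sum.cong[OF refl], rule sum.mono_neutral_left) (use assms in \<open>auto simp: in_keys_iff\<close>)
  also have "\<dots> = (\<Sum>x\<in>X. \<Sum>y\<in>Y. Poly_Mapping.single (x \<otimes>\<^bsub>M\<^esub> y) (Poly_Mapping.lookup p x * Poly_Mapping.lookup r y))"
    by (rule sum.mono_neutral_left) (use assms in \<open>auto simp: in_keys_iff\<close>)
  finally show ?thesis .
qed

lemma monoid_algebra_mult_add_l:
  "(p + p') \<otimes>\<^bsub>monoid_algebra M\<^esub> r = p \<otimes>\<^bsub>monoid_algebra M\<^esub> r + p' \<otimes>\<^bsub>monoid_algebra M\<^esub> r"
proof -
  let ?X = "Poly_Mapping.keys p \<union> Poly_Mapping.keys p'"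
  let ?Y = "Poly_Mapping.keys r"
  have "Poly_Mapping.keys (p+p') \<subseteq> ?X" by (rule Poly_Mapping.keys_add)
  then show ?thesis
    by (simp add: monoid_algebra_mult_sum[where X="?X" and Y="?Y"] lookup_add distrib_right single_add sum.distrib)
qed

lemma monoid_algebra_mult_add_r:
  "r \<otimes>\<^bsub>monoid_algebra M\<^esub> (p + p') = r \<otimes>\<^bsub>monoid_algebra M\<^esub> p + r \<otimes>\<^bsub>monoid_algebra M\<^esub> p'"
proof -
  let ?X = "Poly_Mapping.keys p \<union> Poly_Mapping.keys p'"
  let ?Y = "Poly_Mapping.keys r"
  have "Poly_Mapping.keys (p+p') \<subseteq> ?X" by (rule Poly_Mapping.keys_add)
  then show ?thesis
    by (simp add: monoid_algebra_mult_sum[where Y="?X" and X="?Y"] lookup_add distrib_left single_add sum.distrib)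
qed

lemma monoid_algebra_mult_zero: "0 \<otimes>\<^bsub>monoid_algebra M\<^esub> r = 0" "r \<otimes>\<^bsub>monoid_algebra M\<^esub> 0 = 0"
  by (simp_all add: monoid_algebra_def)

lemma monoid_algebra_mult_single:
 "Poly_Mapping.single x a \<otimes>\<^bsub>monoid_algebra M\<^esub> Poly_Mapping.single y b = Poly_Mapping.single (x \<otimes>\<^bsub>M\<^esub> y) (a * b)"
  by (subst monoid_algebra_mult_sum[where X="{x}" and Y="{y}"]) auto

lemma keys_sum_subset:
  assumes "\<And>x. x \<in> A \<Longrightarrow> Poly_Mapping.keys (f x) \<subseteq> C"
  shows "Poly_Mapping.keys (sum f A) \<subseteq> C"
  using assms
proof (induction A rule: infinite_finite_induct)
  case (insert x F)
  then show ?case using Poly_Mapping.keys_add[of "f x" "sum f F"] by fastforce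
qed auto

lemma monoid_algebra_mult_closed:
  assumes "monoid M" "Poly_Mapping.keys p \<subseteq> carrier M" "Poly_Mapping.keys r \<subseteq> carrier M"
  shows "Poly_Mapping.keys (p \<otimes>\<^bsub>monoid_algebra M\<^esub> r) \<subseteq> carrier M"
proof -
  interpret monoid M by fact
  show ?thesis unfolding monoid_algebra_def
    by (simp, rule keys_sum_subset, rule keys_sum_subset) (use assms(2,3) in auto)
qed

lemma poly_mapping_keys_induct [consumes 1, case_names zero single add]:
  assumes "Poly_Mapping.keys p \<subseteq> C"
  and "P 0" and "\<And>x a. x \<in> C \<Longrightarrow> P (Poly_Mapping.single x a)"
  and "\<And>p r. P p \<Longrightarrow> P r \<Longrightarrow> P (p + r)"
  shows "P (p :: 'm \<Rightarrow>\<^sub>0 'f::field)"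
proof -
  have "P (\<Sum>x\<in>A. Poly_Mapping.single x (Poly_Mapping.lookup p x))" if "finite A" "A \<subseteq> C" for A
    using that by (induction A rule: finite_induct) (auto intro: assms)
  moreover have "p = (\<Sum>x\<in>Poly_Mapping.keys p. Poly_Mapping.single x (Poly_Mapping.lookup p x))"
    by (rule poly_mapping_eqI)
       (simp add: lookup_sum lookup_single when_def in_keys_iff)
  ultimately show ?thesis using assms(1) by (metis finite_keys)
qed

lemma monoid_algebra_ring:
  assumes "monoid M"
  shows "ring (monoid_algebra M :: ('f::field, 'm \<Rightarrow>\<^sub>0 'f) module)"
proof -
  interpret monoid M by fact
  let ?A = "monoid_algebra M :: ('f, 'm \<Rightarrow>\<^sub>0 'f) module"
  have cl: "carrier ?A = {p. Poly_Mapping.keys p \<subseteq> carrier M}" and ad: "add ?A = (+)" and ze: "\<zero>\<^bsub>?A\<^esub> = 0"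
   and on: "\<one>\<^bsub>?A\<^esub> = Poly_Mapping.single \<one>\<^bsub>M\<^esub> 1"
    by (simp_all add: monoid_algebra_def)
  have as: "(p \<otimes>\<^bsub>?A\<^esub> r) \<otimes>\<^bsub>?A\<^esub> s = p \<otimes>\<^bsub>?A\<^esub> (r \<otimes>\<^bsub>?A\<^esub> s)"
    if "Poly_Mapping.keys p \<subseteq> carrier M" "Poly_Mapping.keys r \<subseteq> carrier M" "Poly_Mapping.keys s \<subseteq> carrier M" for p r s
    using that(1)
  proof (induction rule: poly_mapping_keys_induct)
    case (single x a)
    show ?case using that(2)
    proof (induction rule: poly_mapping_keys_induct)
      case (single y b)
      show ?case using that(3)
        by (induction rule: poly_mapping_keys_induct) (use \<open>x \<in> carrier M\<close> \<open>y \<in> carrier M\<close> in \<open>auto simp: monoid_algebra_mult_zero monoid_algebra_mult_single monoid_algebra_mult_add_r m_assoc mult.assoc\<close>)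
    qed (auto simp: monoid_algebra_mult_zero monoid_algebra_mult_add_r monoid_algebra_mult_add_l)
  qed (auto simp: monoid_algebra_mult_zero monoid_algebra_mult_add_r monoid_algebra_mult_add_l)
  have o1: "\<one>\<^bsub>?A\<^esub> \<otimes>\<^bsub>?A\<^esub> p = p" "p \<otimes>\<^bsub>?A\<^esub> \<one>\<^bsub>?A\<^esub> = p" if "Poly_Mapping.keys p \<subseteq> carrier M" for p
    using that by (induction rule: poly_mapping_keys_induct) (auto simp: on monoid_algebra_mult_zero monoid_algebra_mult_single monoid_algebra_mult_add_r monoid_algebra_mult_add_l)
  show ?thesis
  proof (rule ringI)
    show "abelian_group ?A"
    proof (rule abelian_groupI)
      show "\<exists>y\<in>carrier ?A. y \<oplus>\<^bsub>?A\<^esub> x = \<zero>\<^bsub>?A\<^esub>" if "x \<in> carrier ?A" for x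
        using that by (intro bexI[of _ "-x"]) (auto simp: cl ad ze)
    qed (auto simp: cl ad ze ac_simps dest: Poly_Mapping.keys_add[THEN subsetD])
    show "Group.monoid ?A"
      by (rule monoidI) (use monoid_algebra_mult_closed[OF assms, THEN subsetD] as o1 in \<open>auto simp: cl on\<close>)
  qed (simp_all add: ad monoid_algebra_mult_add_l monoid_algebra_mult_add_r)
qed

definition free_algebra :: "('f::field, 'g list \<Rightarrow>\<^sub>0 'f) module" where
  "free_algebra = monoid_algebra \<lparr>carrier = UNIV, mult = (@), one = []\<rparr>"

definition free_gen :: "'g \<Rightarrow> 'g list \<Rightarrow>\<^sub>0 'f::field" where
  "free_gen x = Poly_Mapping.single [x] 1"

text \<open>
  The polynomial algebra \<open>\<F>[z\<^sub>1, z\<^sub>2, \<dots>]\<close>. Monomials are multisets of natural numbers, the variable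
  \<open>z\<^sub>n\<close> for \<open>n \<ge> 1\<close> being represented by the number \<open>n - 1\<close>; also \<open>z\<^sub>0 = 1\<close>.
\<close>

definition poly_algebra :: "('f::field, nat multiset \<Rightarrow>\<^sub>0 'f) module" where
  "poly_algebra = monoid_algebra \<lparr>carrier = UNIV, mult = (+), one = {#}\<rparr>"

definition zvar :: "nat \<Rightarrow> nat multiset \<Rightarrow>\<^sub>0 'f::field" where
  "zvar n = (case n of 0 \<Rightarrow> \<one>\<^bsub>poly_algebra\<^esub> | Suc m \<Rightarrow> Poly_Mapping.single {#m#} 1)"


subsection \<open>Quotients by relations\<close>

text \<open>A relation \<open>u = v\<close> is represented by the pair \<open>(u, v)\<close>.\<close>

definition relation_ideal :: "('f::field, 'a) module \<Rightarrow> ('a \<times> 'a) set \<Rightarrow> 'a set" where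
  "relation_ideal A R = Idl\<^bsub>A\<^esub> {u \<ominus>\<^bsub>A\<^esub> v | u v. (u, v) \<in> R}"

definition quot_algebra :: "('f::field, 'a) module \<Rightarrow> ('a \<times> 'a) set \<Rightarrow> ('f, 'a set) module" where
  "quot_algebra A R =
     ring.extend (A Quot relation_ideal A R)
       (module.fields (\<lambda>c X. \<Union>x \<in> X. relation_ideal A R +>\<^bsub>A\<^esub> (c \<odot>\<^bsub>A\<^esub> x)))"

definition quot_class :: "('f::field, 'a) module \<Rightarrow> ('a \<times> 'a) set \<Rightarrow> 'a \<Rightarrow> 'a set" where
  "quot_class A R x = relation_ideal A R +>\<^bsub>A\<^esub> x"


subsection \<open>Tensor products of algebras\<close>

text \<open>
  The monoid algebra of the product of the multiplicative monoids of \<open>A\<close> and \<open>B\<close> is the vector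
  space with basis \<open>A \<times> B\<close> and multiplication \<open>(a, b) (a', b') = (a a', b b')\<close>. The span of the
  bilinearity relations is already a two-sided ideal, so that the quotient below is the usual
  tensor product.
\<close>

definition bilinear_relations ::
  "('f::field, 'a) module \<Rightarrow> ('f, 'b) module \<Rightarrow>
     (('a \<times> 'b \<Rightarrow>\<^sub>0 'f) \<times> ('a \<times> 'b \<Rightarrow>\<^sub>0 'f)) set" where
  "bilinear_relations A B =
     {(Poly_Mapping.single (a \<oplus>\<^bsub>A\<^esub> a', b) 1,
       Poly_Mapping.single (a, b) 1 + Poly_Mapping.single (a', b) 1) | a a' b.
        a \<in> carrier A \<and> a' \<in> carrier A \<and> b \<in> carrier B} \<union>
     {(Poly_Mapping.single (a, b \<oplus>\<^bsub>B\<^esub> b') 1,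
       Poly_Mapping.single (a, b) 1 + Poly_Mapping.single (a, b') 1) | a b b'.
        a \<in> carrier A \<and> b \<in> carrier B \<and> b' \<in> carrier B} \<union>
     {(Poly_Mapping.single (c \<odot>\<^bsub>A\<^esub> a, b) 1, Poly_Mapping.single (a, b) c) | c a b.
        a \<in> carrier A \<and> b \<in> carrier B} \<union>
     {(Poly_Mapping.single (a, c \<odot>\<^bsub>B\<^esub> b) 1, Poly_Mapping.single (a, b) c) | c a b.
        a \<in> carrier A \<and> b \<in> carrier B}"

definition tensor_algebra ::
  "('f::field, 'a) module \<Rightarrow> ('f, 'b) module \<Rightarrow> ('f, ('a \<times> 'b \<Rightarrow>\<^sub>0 'f) set) module" where
  "tensor_algebra A B = quot_algebra (monoid_algebra (A \<times>\<times> B)) (bilinear_relations A B)"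

definition pure_tensor ::
  "('f::field, 'a) module \<Rightarrow> ('f, 'b) module \<Rightarrow> 'a \<Rightarrow> 'b \<Rightarrow> ('a \<times> 'b \<Rightarrow>\<^sub>0 'f) set" where
  "pure_tensor A B a b =
     quot_class (monoid_algebra (A \<times>\<times> B)) (bilinear_relations A B) (Poly_Mapping.single (a, b) 1)"


section \<open>Power series with coefficients in an algebra\<close>

text \<open>
  A power series \<open>X(t) = \<Sum>n. X\<^sub>n t\<^sup>n\<close> over an algebra is represented by its sequence of coefficients.
  Power series with scalar coefficients are those of the library.
\<close>

definition series_add ::
  "('f::field, 'a) module \<Rightarrow> (nat \<Rightarrow> 'a) \<Rightarrow> (nat \<Rightarrow> 'a) \<Rightarrow> nat \<Rightarrow> 'a" where
  "series_add A X Y n = X n \<oplus>\<^bsub>A\<^esub> Y n"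

definition series_diff ::
  "('f::field, 'a) module \<Rightarrow> (nat \<Rightarrow> 'a) \<Rightarrow> (nat \<Rightarrow> 'a) \<Rightarrow> nat \<Rightarrow> 'a" where
  "series_diff A X Y n = X n \<ominus>\<^bsub>A\<^esub> Y n"

definition series_mult ::
  "('f::field, 'a) module \<Rightarrow> (nat \<Rightarrow> 'a) \<Rightarrow> (nat \<Rightarrow> 'a) \<Rightarrow> nat \<Rightarrow> 'a" where
  "series_mult A X Y n = (\<Oplus>\<^bsub>A\<^esub>k \<in> {..n}. X k \<otimes>\<^bsub>A\<^esub> Y (n - k))"

definition series_smult ::
  "('f::field, 'a) module \<Rightarrow> 'f fps \<Rightarrow> (nat \<Rightarrow> 'a) \<Rightarrow> nat \<Rightarrow> 'a" where
  "series_smult A s X n = (\<Oplus>\<^bsub>A\<^esub>k \<in> {..n}. fps_nth s k \<odot>\<^bsub>A\<^esub> X (n - k))"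

text \<open>
  The substitution \<open>X(s) = \<Sum>k. X\<^sub>k s\<^sup>k\<close> for a scalar power series \<open>s\<close> without constant term, so that
  \<open>s\<^sup>k\<close> contributes to the coefficient of \<open>t\<^sup>n\<close> only for \<open>k \<le> n\<close>.
\<close>

definition series_subst ::
  "('f::field, 'a) module \<Rightarrow> (nat \<Rightarrow> 'a) \<Rightarrow> 'f fps \<Rightarrow> nat \<Rightarrow> 'a" where
  "series_subst A X s n = (\<Oplus>\<^bsub>A\<^esub>k \<in> {..n}. fps_nth (s ^ k) n \<odot>\<^bsub>A\<^esub> X k)"


section \<open>The \<open>q\<close>-Onsager algebra and its alternating central extension\<close>

definition qint :: "'f::field \<Rightarrow> nat \<Rightarrow> 'f" where
  "qint q n = (q ^ n - inverse q ^ n) / (q - inverse q)"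


subsection \<open>The \<open>q\<close>-Onsager algebra\<close>

datatype onsager_gen = GW0 | GW1

definition onsager_relations ::
  "'f::field \<Rightarrow> ((onsager_gen list \<Rightarrow>\<^sub>0 'f) \<times> (onsager_gen list \<Rightarrow>\<^sub>0 'f)) set" where
  "onsager_relations q =
     (let A = free_algebra; W0 = free_gen GW0; W1 = free_gen GW1 in
      {(commutator A W0 (rcommutator A (inverse q) W0 (rcommutator A q W0 W1)),
        (q ^ 2 - inverse q ^ 2) ^ 2 \<odot>\<^bsub>A\<^esub> commutator A W1 W0),
       (commutator A W1 (rcommutator A (inverse q) W1 (rcommutator A q W1 W0)),
        (q ^ 2 - inverse q ^ 2) ^ 2 \<odot>\<^bsub>A\<^esub> commutator A W0 W1)})"

definition Oq :: "'f::field \<Rightarrow> ('f, (onsager_gen list \<Rightarrow>\<^sub>0 'f) set) module" where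
  "Oq q = quot_algebra free_algebra (onsager_relations q)"

definition Oq_gen :: "'f::field \<Rightarrow> onsager_gen \<Rightarrow> (onsager_gen list \<Rightarrow>\<^sub>0 'f) set" where
  "Oq_gen q x = quot_class free_algebra (onsager_relations q) (free_gen x)"


subsection \<open>The alternating central extension\<close>

text \<open>
  The constructors stand for \<open>\<W>\<^bsub>-k\<^esub>\<close>, \<open>\<W>\<^bsub>k+1\<^esub>\<close>, \<open>\<G>\<^bsub>k+1\<^esub>\<close> and \<open>\<G>\<close>-tilde\<open>\<^bsub>k+1\<^esub>\<close>, respectively;
  all indices \<open>k\<close> start at \<open>0\<close>.
\<close>

datatype alt_gen = GWm nat | GWp nat | GG nat | GGt nat

definition alt_relations ::
  "'f::field \<Rightarrow> ((alt_gen list \<Rightarrow>\<^sub>0 'f) \<times> (alt_gen list \<Rightarrow>\<^sub>0 'f)) set" where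
  "alt_relations q =
     (let A = free_algebra; rho = - ((q ^ 2 - inverse q ^ 2) ^ 2);
          Wm = (\<lambda>k. free_gen (GWm k)); Wp = (\<lambda>k. free_gen (GWp k));
          G = (\<lambda>k. free_gen (GG k)); Gt = (\<lambda>k. free_gen (GGt k)) in
      (\<Union>k.
        {(commutator A (Wm 0) (Wp k), inverse (q + inverse q) \<odot>\<^bsub>A\<^esub> (Gt k \<ominus>\<^bsub>A\<^esub> G k)),
         (commutator A (Wm k) (Wp 0), inverse (q + inverse q) \<odot>\<^bsub>A\<^esub> (Gt k \<ominus>\<^bsub>A\<^esub> G k)),
         (rcommutator A q (Wm 0) (G k), (rho \<odot>\<^bsub>A\<^esub> Wm (Suc k)) \<ominus>\<^bsub>A\<^esub> (rho \<odot>\<^bsub>A\<^esub> Wp k)),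
         (rcommutator A q (Gt k) (Wm 0), (rho \<odot>\<^bsub>A\<^esub> Wm (Suc k)) \<ominus>\<^bsub>A\<^esub> (rho \<odot>\<^bsub>A\<^esub> Wp k)),
         (rcommutator A q (G k) (Wp 0), (rho \<odot>\<^bsub>A\<^esub> Wp (Suc k)) \<ominus>\<^bsub>A\<^esub> (rho \<odot>\<^bsub>A\<^esub> Wm k)),
         (rcommutator A q (Wp 0) (Gt k), (rho \<odot>\<^bsub>A\<^esub> Wp (Suc k)) \<ominus>\<^bsub>A\<^esub> (rho \<odot>\<^bsub>A\<^esub> Wm k))}) \<union>
      (\<Union>k l.
        {(commutator A (Wm k) (Wm l), \<zero>\<^bsub>A\<^esub>),
         (commutator A (Wp k) (Wp l), \<zero>\<^bsub>A\<^esub>),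
         (commutator A (Wm k) (Wp l) \<oplus>\<^bsub>A\<^esub> commutator A (Wp k) (Wm l), \<zero>\<^bsub>A\<^esub>),
         (commutator A (Wm k) (G l) \<oplus>\<^bsub>A\<^esub> commutator A (G k) (Wm l), \<zero>\<^bsub>A\<^esub>),
         (commutator A (Wm k) (Gt l) \<oplus>\<^bsub>A\<^esub> commutator A (Gt k) (Wm l), \<zero>\<^bsub>A\<^esub>),
         (commutator A (Wp k) (G l) \<oplus>\<^bsub>A\<^esub> commutator A (G k) (Wp l), \<zero>\<^bsub>A\<^esub>),
         (commutator A (Wp k) (Gt l) \<oplus>\<^bsub>A\<^esub> commutator A (Gt k) (Wp l), \<zero>\<^bsub>A\<^esub>),
         (commutator A (G k) (G l), \<zero>\<^bsub>A\<^esub>),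
         (commutator A (Gt k) (Gt l), \<zero>\<^bsub>A\<^esub>),
         (commutator A (Gt k) (G l) \<oplus>\<^bsub>A\<^esub> commutator A (G k) (Gt l), \<zero>\<^bsub>A\<^esub>)}))"

definition altOq :: "'f::field \<Rightarrow> ('f, (alt_gen list \<Rightarrow>\<^sub>0 'f) set) module" where
  "altOq q = quot_algebra free_algebra (alt_relations q)"

definition alt_class :: "'f::field \<Rightarrow> alt_gen \<Rightarrow> (alt_gen list \<Rightarrow>\<^sub>0 'f) set" where
  "alt_class q x = quot_class free_algebra (alt_relations q) (free_gen x)"

text \<open>
  The coefficient of \<open>t\<^sup>n\<close> in \<open>\<W>\<^sup>-(t)\<close> is \<open>altWm q n\<close> \<open>= \<W>\<^bsub>-n\<^esub>\<close>, and that in \<open>\<W>\<^sup>+(t)\<close> is \<open>altWp q n\<close>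
  \<open>= \<W>\<^bsub>n+1\<^esub>\<close>. In contrast to the constructors \<open>GG\<close> and \<open>GGt\<close>, the index of \<open>altG q n\<close> \<open>= \<G>\<^sub>n\<close> and
  of \<open>altGt q n\<close> is not shifted.
\<close>

definition altWm :: "'f::field \<Rightarrow> nat \<Rightarrow> (alt_gen list \<Rightarrow>\<^sub>0 'f) set" where
  "altWm q n = alt_class q (GWm n)"

definition altWp :: "'f::field \<Rightarrow> nat \<Rightarrow> (alt_gen list \<Rightarrow>\<^sub>0 'f) set" where
  "altWp q n = alt_class q (GWp n)"

definition G0_scalar :: "'f::field \<Rightarrow> 'f" where
  "G0_scalar q = - ((q - inverse q) * qint q 2 ^ 2)"

definition altG :: "'f::field \<Rightarrow> nat \<Rightarrow> (alt_gen list \<Rightarrow>\<^sub>0 'f) set" where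
  "altG q n = (case n of 0 \<Rightarrow> G0_scalar q \<odot>\<^bsub>altOq q\<^esub> \<one>\<^bsub>altOq q\<^esub> | Suc k \<Rightarrow> alt_class q (GG k))"

definition altGt :: "'f::field \<Rightarrow> nat \<Rightarrow> (alt_gen list \<Rightarrow>\<^sub>0 'f) set" where
  "altGt q n = (case n of 0 \<Rightarrow> G0_scalar q \<odot>\<^bsub>altOq q\<^esub> \<one>\<^bsub>altOq q\<^esub> | Suc k \<Rightarrow> alt_class q (GGt k))"


subsection \<open>The central elements \<open>\<Z>\<^sup>\<or>\<^sub>n\<close>\<close>

text \<open>
  The coefficient of \<open>t\<^bsup>2l+1\<^esup>\<close> in \<open>S\<close> is \<open>(q + q\<^sup>-\<^sup>1) (-1)\<^sup>l q\<^bsup>-2l-1\<^esup>\<close>, and that in \<open>T\<close> is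
  \<open>(q + q\<^sup>-\<^sup>1) (-1)\<^sup>l q\<^bsup>2l+1\<^esup>\<close>.
\<close>

definition S_series :: "'f::field \<Rightarrow> 'f fps" where
  "S_series q =
     Abs_fps (\<lambda>n. if odd n then (q + inverse q) * ((-1) ^ (n div 2) * inverse q ^ n) else 0)"

definition T_series :: "'f::field \<Rightarrow> 'f fps" where
  "T_series q = Abs_fps (\<lambda>n. if odd n then (q + inverse q) * ((-1) ^ (n div 2) * q ^ n) else 0)"

text \<open>As Laurent series, \<open>S\<close> and \<open>T\<close> are the two fractions they are expansions of.\<close>

lemma S_series_times:
  assumes "(q::'f::field) \<noteq> 0"
  shows "S_series q * (fps_const (inverse q) * fps_X ^ 2 + fps_const q) = fps_const (q + inverse q) * fps_X"
proof (rule fps_ext)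
  fix n
  have n: "fps_nth (S_series q * (fps_const (inverse q) * fps_X ^ 2 + fps_const q)) n =
      (if n < 2 then 0 else inverse q * fps_nth (S_series q) (n - 2)) + q * fps_nth (S_series q) n"
    by (simp add: distrib_left mult.left_commute[of _ "fps_const _"] mult.commute[of _ "fps_const _"]
        fps_X_power_mult_right_nth)
  consider "n = 0" | "n = 1" | m where "n = m + 2"
    by (metis One_nat_def Suc_1 add_2_eq_Suc' not0_implies_Suc)
  then show "fps_nth (S_series q * (fps_const (inverse q) * fps_X ^ 2 + fps_const q)) n =
      fps_nth (fps_const (q + inverse q) * fps_X) n"
  proof cases
    case 3
    then show ?thesis unfolding n using assms by (simp add: S_series_def field_simps)
  qed (unfold n, use assms in \<open>simp_all add: S_series_def\<close>)
qed

lemma T_series_times: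
  assumes "(q::'f::field) \<noteq> 0"
  shows "T_series q * (fps_const q * fps_X ^ 2 + fps_const (inverse q)) = fps_const (q + inverse q) * fps_X"
proof -
  have "T_series q = S_series (inverse q)" by (simp add: S_series_def T_series_def add.commute[of q] cong: if_cong)
  then show ?thesis using S_series_times[of "inverse q"] assms by (simp add: add.commute)
qed

lemma S_series_fraction:
  assumes "(q::'f::field) \<noteq> 0"
  shows "fps_to_fls (S_series q) =
    fls_const (q + inverse q) / (fls_const (inverse q) * fls_X + fls_const q * fls_X_inv)"
proof -
  let ?D = "fls_const (inverse q) * fls_X + fls_const q * fls_X_inv"
  have X: "fls_X_inv * (fls_X :: 'f fls) = 1"
    by (simp add: fls_X_inv_times_conv_shift)
  have "fps_to_fls (S_series q * (fps_const (inverse q) * fps_X ^ 2 + fps_const q)) = fps_to_fls (fps_const (q + inverse q) * fps_X)"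
    using S_series_times[OF assms] by simp
  then have "fps_to_fls (S_series q) * (fls_const (inverse q) * fls_X ^ 2 + fls_const q) = fls_const (q + inverse q) * fls_X"
    by (simp add: fls_times_fps_to_fls fps_to_fls_plus fps_to_fls_power del: fps_const_add)
  moreover have "fls_const (inverse q) * fls_X ^ 2 + fls_const q = ?D * fls_X"
    using X by (simp add: distrib_right mult.assoc power2_eq_square)
  ultimately have "fps_to_fls (S_series q) * ?D * fls_X = fls_const (q + inverse q) * fls_X"
    by (simp add: mult.assoc)
  then have "fps_to_fls (S_series q) * ?D = fls_const (q + inverse q)" by simp
  moreover have "?D \<noteq> 0"
  proof
    assume "?D = 0"
    then have "fls_nth ?D 1 = 0" by simp
    then show False using assms by simp
  qed
  ultimately show ?thesis by (simp add: eq_divide_eq)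
qed

lemma T_series_fraction:
  assumes "(q::'f::field) \<noteq> 0"
  shows "fps_to_fls (T_series q) =
    fls_const (q + inverse q) / (fls_const q * fls_X + fls_const (inverse q) * fls_X_inv)"
proof -
  have "T_series q = S_series (inverse q)" by (simp add: S_series_def T_series_def add.commute[of q] cong: if_cong)
  then show ?thesis using S_series_fraction[of "inverse q"] assms by (simp add: add.commute)
qed

text \<open>
  The series \<open>S T\<close> is divisible by \<open>t\<close>, so \<open>fps_shift 1 (S T)\<close> is \<open>t\<^sup>-\<^sup>1 S T\<close>.
\<close>

lemma S_T_shift: "fps_X * fps_shift 1 (S_series q * T_series q) = S_series q * T_series q"
proof (rule fps_ext)
  fix n show "fps_nth (fps_X * fps_shift 1 (S_series q * T_series q)) n = fps_nth (S_series q * T_series q) n"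
    by (cases n) (auto simp: S_series_def)
qed

definition Psi :: "'f::field \<Rightarrow> nat \<Rightarrow> (alt_gen list \<Rightarrow>\<^sub>0 'f) set" where
  "Psi q =
     (let A = altOq q; S = S_series q; T = T_series q;
          sub = series_subst A; mul = series_mult A; smul = series_smult A;
          Wm = altWm q; Wp = altWp q; G = altG q; Gt = altGt q in
      series_add A
       (series_diff A
         (series_diff A
           (series_add A
             (smul (fps_shift 1 (S * T)) (mul (sub Wm S) (sub Wp T)))
             (smul (fps_X * S * T) (mul (sub Wp S) (sub Wm T))))
           (smul (fps_const (q ^ 2) * S * T) (mul (sub Wm S) (sub Wm T))))
         (smul (fps_const (inverse q ^ 2) * S * T) (mul (sub Wp S) (sub Wp T))))
       (smul (fps_const (inverse ((q ^ 2 - inverse q ^ 2) ^ 2))) (mul (sub G S) (sub Gt T))))"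

definition Zvee :: "'f::field \<Rightarrow> nat \<Rightarrow> (alt_gen list \<Rightarrow>\<^sub>0 'f) set" where
  "Zvee q n = inverse (qint q 2 ^ 2) \<odot>\<^bsub>altOq q\<^esub> Psi q n"


subsection \<open>The maps \<open>\<gamma>\<close> and \<open>\<phi>\<close> and the central elements \<open>\<Z>\<^sub>n\<close>\<close>

definition is_gamma ::
  "'f::field \<Rightarrow> ((alt_gen list \<Rightarrow>\<^sub>0 'f) set \<Rightarrow> (onsager_gen list \<Rightarrow>\<^sub>0 'f) set) \<Rightarrow> bool" where
  "is_gamma q \<gamma> \<longleftrightarrow>
     \<gamma> \<in> alg_hom (altOq q) (Oq q) \<and>
     \<gamma> (altWm q 0) = Oq_gen q GW0 \<and>
     \<gamma> (altWp q 0) = Oq_gen q GW1 \<and>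
     (\<forall>n \<ge> 1. \<gamma> (Zvee q n) = \<zero>\<^bsub>Oq q\<^esub>)"

text \<open>The elements \<open>G\<^sub>n\<close> and \<open>G\<close>-tilde\<open>\<^sub>n\<close> of \<open>O\<^sub>q\<close> that are obtained from \<open>\<gamma>\<close>, unshifted as above.\<close>

definition imG ::
  "'f::field \<Rightarrow> ((alt_gen list \<Rightarrow>\<^sub>0 'f) set \<Rightarrow> (onsager_gen list \<Rightarrow>\<^sub>0 'f) set) \<Rightarrow>
     nat \<Rightarrow> (onsager_gen list \<Rightarrow>\<^sub>0 'f) set" where
  "imG q \<gamma> n = (case n of 0 \<Rightarrow> G0_scalar q \<odot>\<^bsub>Oq q\<^esub> \<one>\<^bsub>Oq q\<^esub> | Suc k \<Rightarrow> \<gamma> (altG q (Suc k)))"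

definition imGt ::
  "'f::field \<Rightarrow> ((alt_gen list \<Rightarrow>\<^sub>0 'f) set \<Rightarrow> (onsager_gen list \<Rightarrow>\<^sub>0 'f) set) \<Rightarrow>
     nat \<Rightarrow> (onsager_gen list \<Rightarrow>\<^sub>0 'f) set" where
  "imGt q \<gamma> n = (case n of 0 \<Rightarrow> G0_scalar q \<odot>\<^bsub>Oq q\<^esub> \<one>\<^bsub>Oq q\<^esub> | Suc k \<Rightarrow> \<gamma> (altGt q (Suc k)))"

type_synonym 'f Oq_poly =
  "((onsager_gen list \<Rightarrow>\<^sub>0 'f) set \<times> (nat multiset \<Rightarrow>\<^sub>0 'f) \<Rightarrow>\<^sub>0 'f) set"

definition Oq_poly :: "'f::field \<Rightarrow> ('f, 'f Oq_poly) module" where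
  "Oq_poly q = tensor_algebra (Oq q) poly_algebra"

definition tens ::
  "'f::field \<Rightarrow> (onsager_gen list \<Rightarrow>\<^sub>0 'f) set \<Rightarrow> (nat multiset \<Rightarrow>\<^sub>0 'f) \<Rightarrow> 'f Oq_poly" where
  "tens q = pure_tensor (Oq q) poly_algebra"

definition is_varphi ::
  "'f::field \<Rightarrow> ((alt_gen list \<Rightarrow>\<^sub>0 'f) set \<Rightarrow> (onsager_gen list \<Rightarrow>\<^sub>0 'f) set) \<Rightarrow>
     ((alt_gen list \<Rightarrow>\<^sub>0 'f) set \<Rightarrow> 'f Oq_poly) \<Rightarrow> bool" where
  "is_varphi q \<gamma> \<phi> \<longleftrightarrow>
     \<phi> \<in> alg_iso (altOq q) (Oq_poly q) \<and>
     (\<forall>n.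
       \<phi> (altWm q n) = (\<Oplus>\<^bsub>Oq_poly q\<^esub>k \<in> {..n}. tens q (\<gamma> (altWm q (n - k))) (zvar k)) \<and>
       \<phi> (altWp q n) = (\<Oplus>\<^bsub>Oq_poly q\<^esub>k \<in> {..n}. tens q (\<gamma> (altWp q (n - k))) (zvar k)) \<and>
       \<phi> (altG q n) = (\<Oplus>\<^bsub>Oq_poly q\<^esub>k \<in> {..n}. tens q (imG q \<gamma> (n - k)) (zvar k)) \<and>
       \<phi> (altGt q n) = (\<Oplus>\<^bsub>Oq_poly q\<^esub>k \<in> {..n}. tens q (imGt q \<gamma> (n - k)) (zvar k)))"

definition Zcal ::
  "'f::field \<Rightarrow> ((alt_gen list \<Rightarrow>\<^sub>0 'f) set \<Rightarrow> 'f Oq_poly) \<Rightarrow> nat \<Rightarrow> (alt_gen list \<Rightarrow>\<^sub>0 'f) set" where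
  "Zcal q \<phi> n = (THE z. z \<in> center (altOq q) \<and> \<phi> z = tens q \<one>\<^bsub>Oq q\<^esub> (zvar n))"

end

theory Submission
  imports Defs "HOL-Algebra.UnivPoly"
begin

text \<open>
  Write \<open>\<zeta>(t) = \<Sum>n. (1 \<otimes> z\<^sub>n) t\<^sup>n\<close> and let \<open>\<iota>\<close> be the embedding of \<open>O\<^sub>q\<close> as the left tensor factor. The
  isomorphism \<open>\<phi>\<close> of \<^term>\<open>is_varphi\<close> (the paper's \<open>\<varphi>\<close>) sends each of the four generating series
  \<open>X(t)\<close> to \<open>\<iota>(\<gamma>(X(t))) \<zeta>(t)\<close>. As \<open>\<zeta>\<close> is central and every term of \<open>\<Psi>\<close> is a product of a series in \<open>S\<close>
  with a series in \<open>T\<close>, it follows that \<open>\<phi>(\<Z>\<^sup>\<or>(t)) = \<iota>(\<gamma>(\<Z>\<^sup>\<or>(t))) \<zeta>(S) \<zeta>(T)\<close>. Since \<open>\<gamma>\<close> kills \<open>\<Z>\<^sup>\<or>\<^sub>n\<close> for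
  \<open>n \<ge> 1\<close> and \<open>\<Z>\<^sup>\<or>\<^sub>0 = 1\<close>, the first factor is \<open>1\<close>, and \<open>\<phi>\<close> is injective.
\<close>

section \<open>Associative algebras\<close>

text \<open>Scalars form the whole type \<open>'f\<close>, so no carrier condition is put on them.
  As the product need not commute, compatibility with scalars is required in each argument
  separately.\<close>

locale assoc_algebra = ring A for A :: "('f::field, 'a) module" (structure) +
  assumes smult_closed [simp, intro]: "x \<in> carrier A \<Longrightarrow> c \<odot> x \<in> carrier A"
    and smult_add_left: "x \<in> carrier A \<Longrightarrow> (c + d) \<odot> x = c \<odot> x \<oplus> d \<odot> x"
    and smult_add_right:
      "x \<in> carrier A \<Longrightarrow> y \<in> carrier A \<Longrightarrow> c \<odot> (x \<oplus> y) = c \<odot> x \<oplus> c \<odot> y"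
    and smult_smult: "x \<in> carrier A \<Longrightarrow> c \<odot> (d \<odot> x) = (c * d) \<odot> x"
    and smult_one: "x \<in> carrier A \<Longrightarrow> 1 \<odot> x = x"
    and smult_mult_left:
      "x \<in> carrier A \<Longrightarrow> y \<in> carrier A \<Longrightarrow> (c \<odot> x) \<otimes> y = c \<odot> (x \<otimes> y)"
    and smult_mult_right:
      "x \<in> carrier A \<Longrightarrow> y \<in> carrier A \<Longrightarrow> x \<otimes> (c \<odot> y) = c \<odot> (x \<otimes> y)"
begin

lemma smult_zero_left: "x \<in> carrier A \<Longrightarrow> 0 \<odot> x = \<zero>"
  by (metis add.r_cancel_one' add_cancel_left_left smult_add_left smult_closed)

lemma smult_zero_right: "c \<odot> \<zero> = \<zero>"
  by (metis smult_smult smult_zero_left mult_zero_right zero_closed)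

lemma smult_finsum_left:
  assumes "finite I" "x \<in> carrier A"
  shows "(\<Sum>i\<in>I. c i) \<odot> x = (\<Oplus>i\<in>I. c i \<odot> x)"
  using assms by (induction I rule: finite_induct) (auto simp: smult_zero_left smult_add_left)

lemma smult_finsum_right:
  assumes "finite I" "f \<in> I \<rightarrow> carrier A"
  shows "c \<odot> (\<Oplus>i\<in>I. f i) = (\<Oplus>i\<in>I. c \<odot> f i)"
  using assms by (induction I rule: finite_induct) (auto simp: smult_zero_right smult_add_right Pi_iff)

end

lemma (in abelian_monoid) finsum_swap:
  assumes "finite I" "finite J" "\<And>i j. i \<in> I \<Longrightarrow> j \<in> J \<Longrightarrow> f i j \<in> carrier G"
  shows "(\<Oplus>i\<in>I. \<Oplus>j\<in>J. f i j) = (\<Oplus>j\<in>J. \<Oplus>i\<in>I. f i j)"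
  using assms(1,3)
proof (induction I rule: finite_induct)
  case (insert i I)
  then have "(\<Oplus>j\<in>J. \<Oplus>i\<in>insert i I. f i j) = (\<Oplus>j\<in>J. f i j \<oplus> (\<Oplus>i\<in>I. f i j))"
    by (intro finsum_cong' refl) (auto intro!: finsum_closed)
  also have "\<dots> = (\<Oplus>j\<in>J. f i j) \<oplus> (\<Oplus>j\<in>J. \<Oplus>i\<in>I. f i j)"
    using insert.prems by (intro finsum_addf) (auto intro!: finsum_closed)
  finally show ?case using insert by (simp add: Pi_iff finsum_closed)
qed simp

lemma alg_homD:
  assumes "h \<in> alg_hom A B"
  shows "x \<in> carrier A \<Longrightarrow> h x \<in> carrier B"
    and "x \<in> carrier A \<Longrightarrow> y \<in> carrier A \<Longrightarrow> h (x \<otimes>\<^bsub>A\<^esub> y) = h x \<otimes>\<^bsub>B\<^esub> h y"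
    and "x \<in> carrier A \<Longrightarrow> y \<in> carrier A \<Longrightarrow> h (x \<oplus>\<^bsub>A\<^esub> y) = h x \<oplus>\<^bsub>B\<^esub> h y"
    and "h \<one>\<^bsub>A\<^esub> = \<one>\<^bsub>B\<^esub>"
    and "x \<in> carrier A \<Longrightarrow> h (c \<odot>\<^bsub>A\<^esub> x) = c \<odot>\<^bsub>B\<^esub> h x"
  using assms by (auto simp: alg_hom_def ring_hom_def)

lemma alg_hom_comp: "g \<in> alg_hom A B \<Longrightarrow> h \<in> alg_hom B C \<Longrightarrow> h \<circ> g \<in> alg_hom A C"
  by (auto simp: alg_hom_def ring_hom_def Pi_iff)

locale assoc_algebra_hom = A: assoc_algebra A + B: assoc_algebra B
  for A :: "('f::field, 'a) module" and B :: "('f, 'b) module" +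
  fixes h
  assumes hom: "h \<in> alg_hom A B"
begin

lemmas hom_closed [simp, intro] = alg_homD(1)[OF hom]
lemmas hom_mult = alg_homD(2)[OF hom]
lemmas hom_add = alg_homD(3)[OF hom]
lemmas hom_one = alg_homD(4)[OF hom]
lemmas hom_smult = alg_homD(5)[OF hom]

text \<open>A \<open>ring_hom\<close> is only required to preserve products, sums and the unit. Zero
  is preserved because it is a multiple by the scalar 0, and \<open>h\<close> respects
  scalars.\<close>

lemma hom_zero: "h \<zero>\<^bsub>A\<^esub> = \<zero>\<^bsub>B\<^esub>"
  by (metis A.smult_zero_left A.zero_closed B.smult_zero_left hom_closed hom_smult)

lemma hom_minus:
  assumes "x \<in> carrier A" "y \<in> carrier A"
  shows "h (x \<ominus>\<^bsub>A\<^esub> y) = h x \<ominus>\<^bsub>B\<^esub> h y"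
proof -
  have "h (\<ominus>\<^bsub>A\<^esub> y) \<oplus>\<^bsub>B\<^esub> h y = \<zero>\<^bsub>B\<^esub>"
    using assms by (simp flip: hom_add add: A.l_neg hom_zero)
  then have "h (\<ominus>\<^bsub>A\<^esub> y) = \<ominus>\<^bsub>B\<^esub> h y"
    using assms by (intro B.minus_equality[symmetric]) auto
  then show ?thesis using assms by (simp add: A.minus_eq B.minus_eq hom_add)
qed

lemma hom_finsum:
  assumes "finite I" "f \<in> I \<rightarrow> carrier A"
  shows "h (finsum A f I) = (\<Oplus>\<^bsub>B\<^esub>i\<in>I. h (f i))"
  using assms by (induction I rule: finite_induct) (auto simp: hom_zero hom_add Pi_iff)

end

section \<open>Monoid algebras as associative algebras\<close>

lemma monoid_algebra_simps:
  "carrier (monoid_algebra M) = {p. Poly_Mapping.keys p \<subseteq> carrier M}"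
  "\<one>\<^bsub>monoid_algebra M\<^esub> = Poly_Mapping.single \<one>\<^bsub>M\<^esub> 1"
  "\<zero>\<^bsub>monoid_algebra M\<^esub> = 0"
  "p \<oplus>\<^bsub>monoid_algebra M\<^esub> r = p + r"
  "c \<odot>\<^bsub>monoid_algebra M\<^esub> p = Poly_Mapping.map (\<lambda>a. c * a) p"
  by (simp_all add: monoid_algebra_def)

text \<open>\<open>Poly_Mapping.map\<close> applies its function only at nonzero values.
  Multiplication by \<open>c\<close> fixes 0, so this restriction does no harm and the map is
  coefficientwise.\<close>

lemma map_mult_add:
  "Poly_Mapping.map (\<lambda>a. c * a) (p + r) =
    Poly_Mapping.map (\<lambda>a. c * a) p + Poly_Mapping.map (\<lambda>a. c * a :: 'f::field) r"
  by (rule poly_mapping_eqI)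
    (auto simp: Poly_Mapping.map.rep_eq lookup_add when_def simp flip: distrib_left)

lemma map_mult_single:
  "Poly_Mapping.map (\<lambda>a. c * a) (Poly_Mapping.single x a) = Poly_Mapping.single x (c * a :: 'f::field)"
  by (rule poly_mapping_eqI) (auto simp: Poly_Mapping.map.rep_eq lookup_single when_def)

lemma map_mult_zero: "Poly_Mapping.map (\<lambda>a. c * a) 0 = (0 :: 'm \<Rightarrow>\<^sub>0 'f::field)"
  by (rule poly_mapping_eqI) (auto simp: Poly_Mapping.map.rep_eq when_def)

lemma keys_map_mult: "Poly_Mapping.keys (Poly_Mapping.map (\<lambda>a. c * a :: 'f::field) p) \<subseteq> Poly_Mapping.keys p"
  by (auto simp: in_keys_iff Poly_Mapping.map.rep_eq when_def)

lemma monoid_algebra_assoc_algebra: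
  assumes "monoid M"
  shows "assoc_algebra (monoid_algebra M :: ('f::field, 'm \<Rightarrow>\<^sub>0 'f) module)"
proof -
  let ?A = "monoid_algebra M :: ('f, 'm \<Rightarrow>\<^sub>0 'f) module"
  interpret ring ?A by (rule monoid_algebra_ring[OF assms])
  note defs = monoid_algebra_simps monoid_algebra_mult_zero monoid_algebra_mult_single
    monoid_algebra_mult_add_l monoid_algebra_mult_add_r map_mult_add map_mult_single map_mult_zero
  \<comment> \<open>Both identities are additive in \<open>x\<close> and in \<open>y\<close>, so
    induction over the keys reduces them to monomials.\<close>
  have *: "(c \<odot>\<^bsub>?A\<^esub> x) \<otimes>\<^bsub>?A\<^esub> y = c \<odot>\<^bsub>?A\<^esub> (x \<otimes>\<^bsub>?A\<^esub> y) \<and> x \<otimes>\<^bsub>?A\<^esub> (c \<odot>\<^bsub>?A\<^esub> y) = c \<odot>\<^bsub>?A\<^esub> (x \<otimes>\<^bsub>?A\<^esub> y)"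
    if "x \<in> carrier ?A" "y \<in> carrier ?A" for c x y
    using that(1)[unfolded monoid_algebra_simps mem_Collect_eq]
  proof (induction rule: poly_mapping_keys_induct)
    case (single k a)
    show ?case using that(2)[unfolded monoid_algebra_simps mem_Collect_eq]
      by (induction rule: poly_mapping_keys_induct) (simp_all add: defs mult.assoc mult.left_commute[of _ c])
  qed (simp_all add: defs)
  show ?thesis
  proof unfold_locales
    fix x y c d
    assume x: "x \<in> carrier ?A"
    show "c \<odot>\<^bsub>?A\<^esub> x \<in> carrier ?A"
      using x keys_map_mult[of c x] by (auto simp: monoid_algebra_simps)
    show "(c + d) \<odot>\<^bsub>?A\<^esub> x = c \<odot>\<^bsub>?A\<^esub> x \<oplus>\<^bsub>?A\<^esub> d \<odot>\<^bsub>?A\<^esub> x"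
      unfolding monoid_algebra_simps
      by (rule poly_mapping_eqI) (auto simp: Poly_Mapping.map.rep_eq lookup_add when_def distrib_right)
    show "c \<odot>\<^bsub>?A\<^esub> (d \<odot>\<^bsub>?A\<^esub> x) = (c * d) \<odot>\<^bsub>?A\<^esub> x"
      unfolding monoid_algebra_simps
      by (rule poly_mapping_eqI) (auto simp: Poly_Mapping.map.rep_eq when_def)
    show "1 \<odot>\<^bsub>?A\<^esub> x = x"
      unfolding monoid_algebra_simps
      by (rule poly_mapping_eqI) (auto simp: Poly_Mapping.map.rep_eq when_def)
    assume y: "y \<in> carrier ?A"
    show "c \<odot>\<^bsub>?A\<^esub> (x \<oplus>\<^bsub>?A\<^esub> y) = c \<odot>\<^bsub>?A\<^esub> x \<oplus>\<^bsub>?A\<^esub> c \<odot>\<^bsub>?A\<^esub> y"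
      by (simp add: defs)
    show "(c \<odot>\<^bsub>?A\<^esub> x) \<otimes>\<^bsub>?A\<^esub> y = c \<odot>\<^bsub>?A\<^esub> (x \<otimes>\<^bsub>?A\<^esub> y)" "x \<otimes>\<^bsub>?A\<^esub> (c \<odot>\<^bsub>?A\<^esub> y) = c \<odot>\<^bsub>?A\<^esub> (x \<otimes>\<^bsub>?A\<^esub> y)"
      using *[OF x y] by auto
  qed
qed

section \<open>Quotients of algebras by relations\<close>

lemma quot_algebra_simps:
  "carrier (quot_algebra A R) = carrier (A Quot relation_ideal A R)"
  "\<one>\<^bsub>quot_algebra A R\<^esub> = \<one>\<^bsub>A Quot relation_ideal A R\<^esub>"
  "\<zero>\<^bsub>quot_algebra A R\<^esub> = \<zero>\<^bsub>A Quot relation_ideal A R\<^esub>"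
  "X \<otimes>\<^bsub>quot_algebra A R\<^esub> Y = X \<otimes>\<^bsub>A Quot relation_ideal A R\<^esub> Y"
  "X \<oplus>\<^bsub>quot_algebra A R\<^esub> Y = X \<oplus>\<^bsub>A Quot relation_ideal A R\<^esub> Y"
  "c \<odot>\<^bsub>quot_algebra A R\<^esub> X = (\<Union>x \<in> X. relation_ideal A R +>\<^bsub>A\<^esub> (c \<odot>\<^bsub>A\<^esub> x))"
  by (simp_all add: quot_algebra_def ring.defs module.defs)

text \<open>Common setting for \<open>Oq\<close>, \<open>altOq\<close> and tensor products, all of
  which are quotients by the ideal that a set of relations generates.\<close>

locale presented_algebra = assoc_algebra A for A :: "('f::field, 'a) module" (structure) +
  fixes R
  assumes relations: "R \<subseteq> carrier A \<times> carrier A"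
begin

abbreviation "I \<equiv> relation_ideal A R"
abbreviation "Q \<equiv> quot_algebra A R"

lemma relations_subset: "{u \<ominus> v | u v. (u, v) \<in> R} \<subseteq> carrier A"
  using relations by auto

sublocale ideal I A
  unfolding relation_ideal_def by (rule genideal_ideal[OF relations_subset])

lemma quot_carrier: "carrier Q = quot_class A R ` carrier A"
  by (auto simp: quot_algebra_simps FactRing_simps quot_class_def)

lemma quot_class_eqI:
  assumes "x \<in> carrier A" "y \<in> carrier A" "x \<ominus> y \<in> I"
  shows "quot_class A R x = quot_class A R y"
  unfolding quot_class_def
  using assms by (simp add: quotient_eq_iff_same_a_r_cos[OF is_ideal])

lemma quot_class_relation:
  assumes "(u, v) \<in> R"
  shows "quot_class A R u = quot_class A R v"
proof (rule quot_class_eqI)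
  show "u \<ominus> v \<in> I"
    using genideal_self[OF relations_subset] assms unfolding relation_ideal_def by blast
qed (use assms relations in auto)

text \<open>\<open>I\<close> is generated as an ideal of the ring, without reference to scalars. It
  absorbs them because multiplying by the scalar \<open>c\<close> is multiplying by the element
  \<open>c \<odot> \<one>\<close>.\<close>

lemma smult_mem_ideal: "i \<in> I \<Longrightarrow> c \<odot> i \<in> I"
  using I_l_closed[of i "c \<odot> \<one>"] a_subset by (force simp: smult_mult_left)

text \<open>Scalar multiplication on \<open>Q\<close> is a union over all representatives of a
  class. Representatives differ by elements of \<open>I\<close>, and so do their multiples by
  \<open>c\<close>; hence all cosets in the union agree.\<close>

lemma smult_quot_class:
  assumes "x \<in> carrier A"
  shows "c \<odot>\<^bsub>Q\<^esub> quot_class A R x = quot_class A R (c \<odot> x)"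
proof -
  have "I +> (c \<odot> y) = I +> (c \<odot> x)" if "y \<in> I +> x" for y
  proof -
    from that obtain i where i: "i \<in> I" "y = i \<oplus> x" by (auto simp: a_r_coset_def')
    then have "i \<in> carrier A" using a_subset by auto
    then have "c \<odot> y \<ominus> c \<odot> x = c \<odot> i"
      using assms i by (simp add: smult_add_right minus_eq a_assoc r_neg)
    then show ?thesis
      using smult_mem_ideal[OF i(1), of c] \<open>i \<in> carrier A\<close> assms i
      by (intro quot_class_eqI[unfolded quot_class_def]) auto
  qed
  \<comment> \<open>The class is nonempty, so the union of the equal cosets is that coset and not
    the empty set.\<close>
  moreover have "x \<in> I +> x" using assms by (rule a_rcos_self)
  ultimately have "(\<Union>y \<in> I +> x. I +> (c \<odot> y)) = I +> (c \<odot> x)" by blast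
  then show ?thesis by (simp only: quot_algebra_simps quot_class_def)
qed

lemma quot_class_ring_hom: "quot_class A R \<in> ring_hom A Q"
  using rcos_ring_hom by (auto simp: ring_hom_def quot_algebra_simps quot_class_def)

lemma quot_class_alg_hom: "quot_class A R \<in> alg_hom A Q"
  using quot_class_ring_hom by (simp add: alg_hom_def smult_quot_class)

lemmas quot_class_simps =
  alg_homD[OF quot_class_alg_hom]

text \<open>\<open>Q\<close> is the record of the quotient ring extended by a scalar multiplication.
  The ring operations are unchanged, so the axioms carry over one at a time.\<close>

lemma quot_ring: "ring Q"
proof -
  note ax = ring.ring_simprules[OF quotient_is_ring]
  show ?thesis
  proof (rule ringI)
    show "abelian_group Q"
    proof (rule abelian_groupI)
      show "\<exists>y\<in>carrier Q. y \<oplus>\<^bsub>Q\<^esub> x = \<zero>\<^bsub>Q\<^esub>" if "x \<in> carrier Q" for x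
        using that ax(3) ax(9) unfolding quot_algebra_simps by blast
    qed (unfold quot_algebra_simps, (rule ax(1,2,7,8,10); assumption)+)
    show "monoid Q"
      by (rule monoidI) (unfold quot_algebra_simps, (rule ax(5,6,11,12) monoid.r_one[OF ring.is_monoid[OF quotient_is_ring]]; assumption)+)
  qed (unfold quot_algebra_simps, (rule ax(13,23); assumption)+)
qed

lemma quot_assoc_algebra: "assoc_algebra Q"
proof -
  interpret ring Q by (rule quot_ring)
  note s = smult_quot_class quot_class_simps(2,3)[symmetric]
  show ?thesis
    by unfold_locales
      (auto simp: quot_carrier s smult_add_left smult_add_right smult_smult smult_one
        smult_mult_left smult_mult_right)
qed

end


section \<open>Power series\<close>

context assoc_algebra
begin

lemma series_mult_closed [simp]:
  "X \<in> UNIV \<rightarrow> carrier A \<Longrightarrow> Y \<in> UNIV \<rightarrow> carrier A \<Longrightarrow> series_mult A X Y \<in> UNIV \<rightarrow> carrier A"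
  by (auto simp: series_mult_def Pi_iff intro!: finsum_closed)

lemma series_add_closed [simp]:
  "X \<in> UNIV \<rightarrow> carrier A \<Longrightarrow> Y \<in> UNIV \<rightarrow> carrier A \<Longrightarrow> series_add A X Y \<in> UNIV \<rightarrow> carrier A"
  by (auto simp: series_add_def Pi_iff)

lemma series_diff_closed [simp]:
  "X \<in> UNIV \<rightarrow> carrier A \<Longrightarrow> Y \<in> UNIV \<rightarrow> carrier A \<Longrightarrow> series_diff A X Y \<in> UNIV \<rightarrow> carrier A"
  by (auto simp: series_diff_def Pi_iff)

lemma series_smult_closed [simp]:
  "X \<in> UNIV \<rightarrow> carrier A \<Longrightarrow> series_smult A c X \<in> UNIV \<rightarrow> carrier A"
  by (auto simp: series_smult_def Pi_iff intro!: finsum_closed)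

lemma series_subst_closed [simp]:
  "X \<in> UNIV \<rightarrow> carrier A \<Longrightarrow> series_subst A X s \<in> UNIV \<rightarrow> carrier A"
  by (auto simp: series_subst_def Pi_iff intro!: finsum_closed)

text \<open>
  The coefficient of \<open>t\<^sup>n\<close> only depends on the truncations of the three series to degree \<open>n\<close>,
  which are polynomials.
\<close>

lemma series_mult_assoc:
  assumes X: "X \<in> UNIV \<rightarrow> carrier A" and Y: "Y \<in> UNIV \<rightarrow> carrier A" and Z: "Z \<in> UNIV \<rightarrow> carrier A"
  shows "series_mult A (series_mult A X Y) Z = series_mult A X (series_mult A Y Z)"
proof
  fix n :: nat
  have cong: "series_mult A X Y m = series_mult A X' Y' m"
    if "X' \<in> UNIV \<rightarrow> carrier A" "Y' \<in> UNIV \<rightarrow> carrier A" "m \<le> n"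
      "\<And>i. i \<le> n \<Longrightarrow> X i = X' i" "\<And>i. i \<le> n \<Longrightarrow> Y i = Y' i" for X Y X' Y' m
    using that unfolding series_mult_def by (intro finsum_cong') (auto simp: Pi_iff)
  \<comment> \<open>The product of the polynomial ring \<open>UP A\<close> is the same convolution,
    so its associative law applies to the truncations \<open>?t\<close>.\<close>
  interpret UP_ring A "UP A" by unfold_locales simp
  let ?t = "\<lambda>(X :: nat \<Rightarrow> 'a) i. if i \<le> n then X i else \<zero>"
  have t: "?t X \<in> up A" if "X \<in> UNIV \<rightarrow> carrier A" for X
    using that by (auto intro!: mem_upI exI[of _ n])
  have mult: "X \<otimes>\<^bsub>UP A\<^esub> Y = series_mult A X Y" if "X \<in> up A" "Y \<in> up A" for X Y
    using that by (simp add: UP_def series_mult_def fun_eq_iff)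
  note [simp] = t[OF X] t[OF Y] t[OF Z]
  have cl: "?t X \<in> UNIV \<rightarrow> carrier A" if "X \<in> UNIV \<rightarrow> carrier A" for X
    using that by auto
  note cls = X Y Z cl[OF X] cl[OF Y] cl[OF Z]
  have carrier: "carrier (UP A) = up A" by (simp add: UP_def)
  have "series_mult A X Y \<in> up A" if "X \<in> up A" "Y \<in> up A" for X Y
    using UP_mult_closed[of X Y] that by (simp add: carrier mult)
  then have up: "series_mult A (?t X) (?t Y) \<in> up A" "series_mult A (?t Y) (?t Z) \<in> up A"
    by simp_all
  have "series_mult A (series_mult A X Y) Z n = series_mult A (series_mult A (?t X) (?t Y)) (?t Z) n"
    using cls by (intro cong) (auto intro!: cong series_mult_closed)
  also have "\<dots> = ((?t X \<otimes>\<^bsub>UP A\<^esub> ?t Y) \<otimes>\<^bsub>UP A\<^esub> ?t Z) n"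
    using up by (simp only: mult t[OF X] t[OF Y] t[OF Z])
  also have "\<dots> = (?t X \<otimes>\<^bsub>UP A\<^esub> (?t Y \<otimes>\<^bsub>UP A\<^esub> ?t Z)) n"
    by (subst UP_m_assoc) (simp_all add: carrier)
  also have "\<dots> = series_mult A (?t X) (series_mult A (?t Y) (?t Z)) n"
    using up by (simp only: mult t[OF X] t[OF Y] t[OF Z])
  also have "\<dots> = series_mult A X (series_mult A Y Z) n"
    using cls by (intro cong[symmetric]) (auto intro!: cong[symmetric] series_mult_closed)
  finally show "series_mult A (series_mult A X Y) Z n = series_mult A X (series_mult A Y Z) n" .
qed

section \<open>Central elements and series with central coefficients\<close>

lemma centerD: "z \<in> center A \<Longrightarrow> z \<in> carrier A" "z \<in> center A \<Longrightarrow> x \<in> carrier A \<Longrightarrow> z \<otimes> x = x \<otimes> z"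
  by (auto simp: center_def)

lemma center_smult: "z \<in> center A \<Longrightarrow> c \<odot> z \<in> center A"
  by (auto simp: center_def smult_mult_left smult_mult_right)

lemma center_finsum:
  assumes "finite I" "\<And>i. i \<in> I \<Longrightarrow> f i \<in> center A"
  shows "finsum A f I \<in> center A"
proof -
  have f: "f \<in> I \<rightarrow> carrier A" using assms(2) by (auto simp: centerD)
  have "finsum A f I \<otimes> x = x \<otimes> finsum A f I" if x: "x \<in> carrier A" for x
    using x f assms(2) by (auto simp: finsum_ldistr[OF assms(1)] finsum_rdistr[OF assms(1)] centerD Pi_iff
        intro!: finsum_cong')
  then show ?thesis using f by (simp add: center_def finsum_closed)
qed

text \<open>Reversing the summation index swaps the roles of the two indices, after which each
  product commutes by centrality.\<close>

lemma series_mult_central: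
  assumes X: "X \<in> UNIV \<rightarrow> carrier A" and Z: "Z \<in> UNIV \<rightarrow> center A"
  shows "series_mult A Z X = series_mult A X Z"
proof
  fix n :: nat
  have Z': "Z \<in> UNIV \<rightarrow> carrier A" using Z by (auto simp: centerD Pi_iff)
  have im: "(\<lambda>k. n - k) ` {..n} = {..n}"
  proof
    show "{..n} \<subseteq> (\<lambda>k. n - k) ` {..n}"
    proof
      fix k assume "k \<in> {..n}"
      then show "k \<in> (\<lambda>k. n - k) ` {..n}" by (intro image_eqI[of _ _ "n - k"]) auto
    qed
  qed auto
  have "series_mult A Z X n = (\<Oplus>k\<in>(\<lambda>k. n - k) ` {..n}. Z k \<otimes> X (n - k))"
    by (simp only: series_mult_def im)
  also have "\<dots> = (\<Oplus>k\<in>{..n}. Z (n - k) \<otimes> X (n - (n - k)))"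
    using X Z' by (intro finsum_reindex) (auto simp: Pi_iff inj_on_def)
  also have "\<dots> = series_mult A X Z n"
    unfolding series_mult_def using X Z Z' by (intro finsum_cong') (auto simp: Pi_iff centerD)
  finally show "series_mult A Z X n = series_mult A X Z n" .
qed

lemma series_subst_central:
  assumes "Z \<in> UNIV \<rightarrow> center A"
  shows "series_subst A Z s \<in> UNIV \<rightarrow> center A"
  using assms by (auto simp: series_subst_def Pi_iff intro!: center_finsum center_smult)

text \<open>A scalar series is turned into a series of multiples of \<open>\<one>\<close>, so that
  associativity of \<open>series_mult\<close> also covers scalar factors.\<close>

lemma series_smult_conv_mult:
  assumes "X \<in> UNIV \<rightarrow> carrier A"
  shows "series_smult A c X = series_mult A (\<lambda>n. fps_nth c n \<odot> \<one>) X"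
  using assms unfolding series_smult_def series_mult_def
  by (intro ext finsum_cong') (auto simp: smult_mult_left Pi_iff)

lemma series_smult_mult:
  assumes "X \<in> UNIV \<rightarrow> carrier A" "Y \<in> UNIV \<rightarrow> carrier A"
  shows "series_smult A c (series_mult A X Y) = series_mult A (series_smult A c X) Y"
proof -
  have "(\<lambda>n. fps_nth c n \<odot> \<one>) \<in> UNIV \<rightarrow> carrier A" by auto
  then show ?thesis using assms by (simp add: series_smult_conv_mult series_mult_assoc)
qed

section \<open>Linearity of the product of series\<close>

lemma series_mult_add_left:
  assumes "X \<in> UNIV \<rightarrow> carrier A" "Y \<in> UNIV \<rightarrow> carrier A" "Z \<in> UNIV \<rightarrow> carrier A"
  shows "series_mult A (series_add A X Y) Z = series_add A (series_mult A X Z) (series_mult A Y Z)"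
proof
  fix n :: nat
  have "series_mult A (series_add A X Y) Z n = (\<Oplus>k\<in>{..n}. X k \<otimes> Z (n - k) \<oplus> Y k \<otimes> Z (n - k))"
    unfolding series_mult_def series_add_def
    using assms by (intro finsum_cong') (auto simp: Pi_iff l_distr)
  also have "\<dots> = series_add A (series_mult A X Z) (series_mult A Y Z) n"
    unfolding series_mult_def series_add_def
    using assms by (intro finsum_addf) (auto simp: Pi_iff)
  finally show "series_mult A (series_add A X Y) Z n = series_add A (series_mult A X Z) (series_mult A Y Z) n" .
qed

text \<open>Reduces differences to sums and scalar multiples, for which distributivity over series
  products is available.\<close>

lemma minus_conv_smult: "x \<in> carrier A \<Longrightarrow> y \<in> carrier A \<Longrightarrow> x \<ominus> y = x \<oplus> (-1) \<odot> y"
proof -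
  assume xy: "x \<in> carrier A" "y \<in> carrier A"
  have "(-1) \<odot> y \<oplus> y = ((-1) + 1) \<odot> y"
    using xy by (simp only: smult_add_left smult_one)
  then have "(-1) \<odot> y = \<ominus> y"
    using xy by (intro minus_equality[symmetric]) (auto simp: smult_zero_left)
  then show ?thesis by (simp add: minus_eq)
qed

lemma series_mult_smult_left:
  assumes "X \<in> UNIV \<rightarrow> carrier A" "Y \<in> UNIV \<rightarrow> carrier A"
  shows "series_mult A (\<lambda>n. c \<odot> X n) Y = (\<lambda>n. c \<odot> series_mult A X Y n)"
  using assms unfolding fun_eq_iff series_mult_def
  by (subst smult_finsum_right) (auto simp: Pi_iff smult_mult_left intro!: finsum_cong')

lemma series_mult_diff_left:
  assumes "X \<in> UNIV \<rightarrow> carrier A" "Y \<in> UNIV \<rightarrow> carrier A" "Z \<in> UNIV \<rightarrow> carrier A"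
  shows "series_mult A (series_diff A X Y) Z = series_diff A (series_mult A X Z) (series_mult A Y Z)"
proof -
  have diff: "series_diff A X Y = series_add A X (\<lambda>n. (-1) \<odot> Y n)"
    if "X \<in> UNIV \<rightarrow> carrier A" "Y \<in> UNIV \<rightarrow> carrier A" for X Y
    using that by (auto simp: series_diff_def series_add_def minus_conv_smult Pi_iff)
  have "series_mult A (series_diff A X Y) Z
      = series_add A (series_mult A X Z) (series_mult A (\<lambda>n. (-1) \<odot> Y n) Z)"
    using assms by (subst diff; simp add: series_mult_add_left Pi_iff)
  also have "\<dots> = series_add A (series_mult A X Z) (\<lambda>n. (-1) \<odot> series_mult A Y Z n)"
    using assms by (simp add: series_mult_smult_left)
  also have "\<dots> = series_diff A (series_mult A X Z) (series_mult A Y Z)"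
    using assms by (subst diff) auto
  finally show ?thesis .
qed

lemma series_mult_one_left:
  assumes "X \<in> UNIV \<rightarrow> carrier A"
  shows "series_mult A (\<lambda>n. if n = 0 then \<one> else \<zero>) X = X"
proof
  fix n :: nat
  have "series_mult A (\<lambda>n. if n = 0 then \<one> else \<zero>) X n = (\<Oplus>k\<in>{..n}. if 0 = k then X (n - k) else \<zero>)"
    unfolding series_mult_def using assms by (intro finsum_cong') (auto simp: Pi_iff)
  also have "\<dots> = X n"
    using assms by (subst finsum_singleton) (auto simp: Pi_iff)
  finally show "series_mult A (\<lambda>n. if n = 0 then \<one> else \<zero>) X n = X n" .
qed

section \<open>Substitution respects products of series\<close>

text \<open>The triangular sum becomes a sum over a full square with an indicator. The ranges then
  depend only on the bound \<open>N\<close>, so that further sums can be interchanged with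
  them.\<close>

lemma series_mult_nth_square:
  assumes "X \<in> UNIV \<rightarrow> carrier A" "Y \<in> UNIV \<rightarrow> carrier A" "n \<le> N"
  shows "series_mult A X Y n = (\<Oplus>i\<in>{..N}. \<Oplus>j\<in>{..N}. of_bool (i + j = n) \<odot> (X i \<otimes> Y j))"
proof -
  have XY: "X i \<otimes> Y j \<in> carrier A" for i j using assms by auto
  have "(\<Oplus>j\<in>{..N}. of_bool (i + j = n) \<odot> (X i \<otimes> Y j)) = X i \<otimes> Y (n - i)" if "i \<le> n" for i
  proof -
    have "(\<Oplus>j\<in>{..N}. of_bool (i + j = n) \<odot> (X i \<otimes> Y j))
        = (\<Oplus>j\<in>{..N}. if n - i = j then X i \<otimes> Y j else \<zero>)"
      using XY that by (intro finsum_cong') (auto simp: smult_zero_left smult_one)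
    also have "\<dots> = X i \<otimes> Y (n - i)"
      using XY assms that by (subst finsum_singleton) auto
    finally show ?thesis .
  qed
  \<comment> \<open>Rows beyond \<open>n\<close> vanish, so the outer sum may run up to
    \<open>N\<close>.\<close>
  moreover have "(\<Oplus>j\<in>{..N}. of_bool (i + j = n) \<odot> (X i \<otimes> Y j)) = \<zero>" if "i > n" for i
    using that XY by (intro add.finprod_one_eqI) (auto simp: smult_zero_left)
  ultimately show ?thesis
    unfolding series_mult_def using assms XY
    by (intro add.finprod_mono_neutral_cong_left) (auto intro!: finsum_closed)
qed

text \<open>Moving the sum over \<open>K\<close> innermost leaves a sum of scalars in front of each
  \<open>f i j\<close>. It serves in both directions: to collect scalars and to spread them out
  again.\<close>

lemma finsum_smult_collect:
  assumes "finite K" "finite I" "finite J" "\<And>i j. i \<in> I \<Longrightarrow> j \<in> J \<Longrightarrow> f i j \<in> carrier A"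
  shows "(\<Oplus>k\<in>K. \<Oplus>i\<in>I. \<Oplus>j\<in>J. c k i j \<odot> f i j) = (\<Oplus>i\<in>I. \<Oplus>j\<in>J. (\<Sum>k\<in>K. c k i j) \<odot> f i j)"
proof -
  have "(\<Oplus>k\<in>K. \<Oplus>i\<in>I. \<Oplus>j\<in>J. c k i j \<odot> f i j) = (\<Oplus>i\<in>I. \<Oplus>k\<in>K. \<Oplus>j\<in>J. c k i j \<odot> f i j)"
    using assms by (intro finsum_swap) (auto intro!: finsum_closed)
  also have "\<dots> = (\<Oplus>i\<in>I. \<Oplus>j\<in>J. \<Oplus>k\<in>K. c k i j \<odot> f i j)"
    using assms by (intro finsum_cong' finsum_swap) (auto intro!: finsum_closed)
  also have "\<dots> = (\<Oplus>i\<in>I. \<Oplus>j\<in>J. (\<Sum>k\<in>K. c k i j) \<odot> f i j)"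
    using assms by (intro finsum_cong' smult_finsum_left[symmetric]) (auto intro!: finsum_closed)
  finally show ?thesis .
qed

text \<open>In degree \<open>n\<close> both sides are the sum over \<open>i\<close> and
  \<open>j\<close> of the coefficient of \<open>s ^ (i + j)\<close> times
  \<open>X i \<otimes> Y j\<close>. Since \<open>s\<close> has no constant term, only
  \<open>i\<close> and \<open>j\<close> up to \<open>n\<close> contribute.\<close>

lemma series_subst_mult:
  assumes X: "X \<in> UNIV \<rightarrow> carrier A" and Y: "Y \<in> UNIV \<rightarrow> carrier A" and s: "fps_nth s 0 = 0"
  shows "series_subst A (series_mult A X Y) s = series_mult A (series_subst A X s) (series_subst A Y s)"
proof
  fix n :: nat
  have XY: "X i \<otimes> Y j \<in> carrier A" and X': "X i \<in> carrier A" and Y': "Y i \<in> carrier A" for i j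
    using X Y by auto
  \<comment> \<open>All substitutions are brought to the common range up to \<open>n\<close>; the
    added terms vanish because \<open>s ^ k\<close> has no terms below degree
    \<open>k\<close>.\<close>
  have extend: "series_subst A X s m = (\<Oplus>k\<in>{..n}. fps_nth (s ^ k) m \<odot> X k)"
    if "m \<le> n" "X \<in> UNIV \<rightarrow> carrier A" for m X
    unfolding series_subst_def using that s
    by (intro add.finprod_mono_neutral_cong_left)
      (auto simp: startsby_zero_power_prefix smult_zero_left Pi_iff)
  \<comment> \<open>The indicator selects \<open>k = i + j\<close>. If this exceeds
    \<open>n\<close>, the sum is empty of nonzero terms, and the coefficient of
    \<open>s ^ (i + j)\<close> in degree \<open>n\<close> is zero as well. Splitting the power then
    gives the convolution.\<close>
  have coeff: "(\<Sum>k\<in>{..n}. fps_nth (s ^ k) n * of_bool (i + j = k))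
      = (\<Sum>m\<in>{..n}. fps_nth (s ^ i) m * fps_nth (s ^ j) (n - m))" for i j
  proof -
    have "(\<Sum>k\<in>{..n}. fps_nth (s ^ k) n * of_bool (i + j = k)) = fps_nth (s ^ (i + j)) n"
      using s by (auto simp: startsby_zero_power_prefix of_bool_def if_distrib[of "\<lambda>x. _ * x"] cong: if_cong)
    then show ?thesis by (simp add: power_add fps_mult_nth atLeast0AtMost)
  qed
  have "series_subst A (series_mult A X Y) s n
      = (\<Oplus>k\<in>{..n}. \<Oplus>i\<in>{..n}. \<Oplus>j\<in>{..n}. (fps_nth (s ^ k) n * of_bool (i + j = k)) \<odot> (X i \<otimes> Y j))"
    unfolding series_subst_def using XY X Y
    by (intro finsum_cong' refl)
      (auto simp: series_mult_nth_square[of X Y _ n] smult_finsum_right smult_smult Pi_iff intro!: finsum_closed finsum_cong')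
  also have "\<dots> = (\<Oplus>i\<in>{..n}. \<Oplus>j\<in>{..n}. (\<Sum>k\<in>{..n}. fps_nth (s ^ k) n * of_bool (i + j = k)) \<odot> (X i \<otimes> Y j))"
    using XY by (intro finsum_smult_collect) auto
  also have "\<dots> = (\<Oplus>i\<in>{..n}. \<Oplus>j\<in>{..n}. (\<Sum>m\<in>{..n}. fps_nth (s ^ i) m * fps_nth (s ^ j) (n - m)) \<odot> (X i \<otimes> Y j))"
    by (simp only: coeff)
  also have "(\<Oplus>i\<in>{..n}. \<Oplus>j\<in>{..n}. (\<Sum>m\<in>{..n}. fps_nth (s ^ i) m * fps_nth (s ^ j) (n - m)) \<odot> (X i \<otimes> Y j))
      = (\<Oplus>m\<in>{..n}. \<Oplus>i\<in>{..n}. \<Oplus>j\<in>{..n}. (fps_nth (s ^ i) m * fps_nth (s ^ j) (n - m)) \<odot> (X i \<otimes> Y j))"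
    using XY by (intro finsum_smult_collect[symmetric]) auto
  also have "\<dots> = (\<Oplus>m\<in>{..n}. series_subst A X s m \<otimes> series_subst A Y s (n - m))"
  proof (intro finsum_cong' refl)
    fix m assume "m \<in> {..n}"
    then have "series_subst A X s m \<otimes> series_subst A Y s (n - m)
        = (\<Oplus>i\<in>{..n}. fps_nth (s ^ i) m \<odot> X i) \<otimes> (\<Oplus>j\<in>{..n}. fps_nth (s ^ j) (n - m) \<odot> Y j)"
      using X Y by (simp add: extend)
    also have "\<dots> = (\<Oplus>i\<in>{..n}. \<Oplus>j\<in>{..n}. (fps_nth (s ^ i) m \<odot> X i) \<otimes> (fps_nth (s ^ j) (n - m) \<odot> Y j))"
      using X' Y' by (subst finsum_ldistr; (intro finsum_cong' refl finsum_rdistr)?) (auto intro!: finsum_closed)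
    also have "\<dots> = (\<Oplus>i\<in>{..n}. \<Oplus>j\<in>{..n}. (fps_nth (s ^ i) m * fps_nth (s ^ j) (n - m)) \<odot> (X i \<otimes> Y j))"
      using X' Y' by (intro finsum_cong' refl)
        (auto simp: smult_mult_left smult_mult_right smult_smult mult.commute intro!: finsum_closed)
    finally show "(\<Oplus>i\<in>{..n}. \<Oplus>j\<in>{..n}. (fps_nth (s ^ i) m * fps_nth (s ^ j) (n - m)) \<odot> (X i \<otimes> Y j))
        = series_subst A X s m \<otimes> series_subst A Y s (n - m)" by simp
  qed (use X Y in \<open>auto simp: Pi_iff series_subst_closed[THEN funcset_mem]\<close>)
  finally show "series_subst A (series_mult A X Y) s n = series_mult A (series_subst A X s) (series_subst A Y s) n"
    by (simp add: series_mult_def)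
qed

text \<open>This handles one term of \<open>Psi\<close>. After multiplicativity of substitution, the
  central factor \<open>Z(s)\<close> only has to be moved past \<open>Y(t)\<close>, and the rest is
  reassociation.\<close>

lemma series_mult_subst_central:
  assumes "X \<in> UNIV \<rightarrow> carrier A" "Y \<in> UNIV \<rightarrow> carrier A" "Z \<in> UNIV \<rightarrow> center A"
    and "fps_nth s 0 = 0" "fps_nth t 0 = 0"
  shows "series_smult A c (series_mult A (series_subst A (series_mult A X Z) s) (series_subst A (series_mult A Y Z) t))
    = series_mult A (series_smult A c (series_mult A (series_subst A X s) (series_subst A Y t)))
        (series_mult A (series_subst A Z s) (series_subst A Z t))"
proof -
  let ?Xs = "series_subst A X s" and ?Yt = "series_subst A Y t"
  let ?Zs = "series_subst A Z s" and ?Zt = "series_subst A Z t"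
  have Z: "Z \<in> UNIV \<rightarrow> carrier A" using assms(3) by (auto simp: centerD Pi_iff)
  have comm: "series_mult A ?Zs ?Yt = series_mult A ?Yt ?Zs"
    using assms by (intro series_mult_central series_subst_central) auto
  have "series_mult A (series_mult A ?Xs ?Zs) (series_mult A ?Yt ?Zt)
      = series_mult A ?Xs (series_mult A (series_mult A ?Zs ?Yt) ?Zt)"
    using assms Z by (simp add: series_mult_assoc)
  also have "\<dots> = series_mult A (series_mult A ?Xs ?Yt) (series_mult A ?Zs ?Zt)"
    using assms Z by (simp add: comm series_mult_assoc)
  finally show ?thesis
    using assms Z by (simp add: series_subst_mult series_smult_mult)
qed

end

section \<open>Homomorphisms applied to series coefficientwise\<close>

context assoc_algebra_hom
begin

lemma hom_series_add:
  assumes "X \<in> UNIV \<rightarrow> carrier A" "Y \<in> UNIV \<rightarrow> carrier A"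
  shows "h \<circ> series_add A X Y = series_add B (h \<circ> X) (h \<circ> Y)"
  using assms by (auto simp: series_add_def fun_eq_iff hom_add Pi_iff)

lemma hom_series_diff:
  assumes "X \<in> UNIV \<rightarrow> carrier A" "Y \<in> UNIV \<rightarrow> carrier A"
  shows "h \<circ> series_diff A X Y = series_diff B (h \<circ> X) (h \<circ> Y)"
  using assms by (auto simp: series_diff_def fun_eq_iff hom_minus Pi_iff)

lemma hom_series_mult:
  assumes "X \<in> UNIV \<rightarrow> carrier A" "Y \<in> UNIV \<rightarrow> carrier A"
  shows "h \<circ> series_mult A X Y = series_mult B (h \<circ> X) (h \<circ> Y)"
  using assms by (auto simp: series_mult_def fun_eq_iff hom_finsum hom_mult Pi_iff intro!: B.finsum_cong')

lemma hom_series_smult: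
  assumes "X \<in> UNIV \<rightarrow> carrier A"
  shows "h \<circ> series_smult A c X = series_smult B c (h \<circ> X)"
  using assms by (auto simp: series_smult_def fun_eq_iff hom_finsum hom_smult Pi_iff intro!: B.finsum_cong')

lemma hom_series_subst:
  assumes "X \<in> UNIV \<rightarrow> carrier A"
  shows "h \<circ> series_subst A X s = series_subst B (h \<circ> X) s"
  using assms by (auto simp: series_subst_def fun_eq_iff hom_finsum hom_smult Pi_iff intro!: B.finsum_cong')

end


section \<open>The form of the series \<open>\<Psi>\<close>\<close>

text \<open>The expression for \<open>Psi\<close> with the algebra and the four generating series as
  parameters, so that it can also be evaluated in \<open>Oq_poly\<close> at the images of the
  generators.\<close>

definition psi_form ::
  "('f::field, 'a) module \<Rightarrow> 'f \<Rightarrow> (nat \<Rightarrow> 'a) \<Rightarrow> (nat \<Rightarrow> 'a) \<Rightarrow> (nat \<Rightarrow> 'a) \<Rightarrow> (nat \<Rightarrow> 'a) \<Rightarrow> nat \<Rightarrow> 'a" where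
  "psi_form A q Wm Wp G Gt =
     (let S = S_series q; T = T_series q;
          sub = series_subst A; mul = series_mult A; smul = series_smult A in
      series_add A
       (series_diff A
         (series_diff A
           (series_add A
             (smul (fps_shift 1 (S * T)) (mul (sub Wm S) (sub Wp T)))
             (smul (fps_X * S * T) (mul (sub Wp S) (sub Wm T))))
           (smul (fps_const (q ^ 2) * S * T) (mul (sub Wm S) (sub Wm T))))
         (smul (fps_const (inverse q ^ 2) * S * T) (mul (sub Wp S) (sub Wp T))))
       (smul (fps_const (inverse ((q ^ 2 - inverse q ^ 2) ^ 2))) (mul (sub G S) (sub Gt T))))"

lemma Psi_eq_psi_form: "Psi q = psi_form (altOq q) q (altWm q) (altWp q) (altG q) (altGt q)"
  by (simp only: Psi_def psi_form_def Let_def)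

lemma S_series_0: "fps_nth (S_series q) 0 = 0" and T_series_0: "fps_nth (T_series q) 0 = 0"
  by (simp_all add: S_series_def T_series_def)

context assoc_algebra
begin

lemma psi_form_closed:
  assumes "Wm \<in> UNIV \<rightarrow> carrier A" "Wp \<in> UNIV \<rightarrow> carrier A" "G \<in> UNIV \<rightarrow> carrier A" "Gt \<in> UNIV \<rightarrow> carrier A"
  shows "psi_form A q Wm Wp G Gt \<in> UNIV \<rightarrow> carrier A"
  using assms by (simp add: psi_form_def Let_def)

text \<open>All five terms acquire the same right factor \<open>Z(S) Z(T)\<close>, which
  distributivity then takes out of the whole expression.\<close>

lemma psi_form_mult_central:
  assumes "Wm \<in> UNIV \<rightarrow> carrier A" "Wp \<in> UNIV \<rightarrow> carrier A" "G \<in> UNIV \<rightarrow> carrier A" "Gt \<in> UNIV \<rightarrow> carrier A"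
    and Z: "Z \<in> UNIV \<rightarrow> center A"
  shows "psi_form A q (series_mult A Wm Z) (series_mult A Wp Z) (series_mult A G Z) (series_mult A Gt Z)
    = series_mult A (psi_form A q Wm Wp G Gt)
        (series_mult A (series_subst A Z (S_series q)) (series_subst A Z (T_series q)))"
proof -
  have "Z \<in> UNIV \<rightarrow> carrier A" using Z by (auto simp: centerD Pi_iff)
  then show ?thesis
    using assms unfolding psi_form_def Let_def
    by (simp add: series_mult_subst_central S_series_0 T_series_0 series_mult_add_left series_mult_diff_left)
qed

text \<open>\<open>S\<close> and \<open>T\<close> have no constant term, so the four terms in
  \<open>Wm\<close> and \<open>Wp\<close> vanish at \<open>t = 0\<close> and only the last one is
  left.\<close>

lemma psi_form_nth_0:
  assumes "Wm \<in> UNIV \<rightarrow> carrier A" "Wp \<in> UNIV \<rightarrow> carrier A" "G \<in> UNIV \<rightarrow> carrier A" "Gt \<in> UNIV \<rightarrow> carrier A"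
  shows "psi_form A q Wm Wp G Gt 0 = inverse ((q ^ 2 - inverse q ^ 2) ^ 2) \<odot> (G 0 \<otimes> Gt 0)"
proof -
  have smult: "series_smult A c X 0 = fps_nth c 0 \<odot> X 0" if "X \<in> UNIV \<rightarrow> carrier A" for c X
    using that by (simp add: series_smult_def Pi_iff)
  have mult: "series_mult A X Y 0 = X 0 \<otimes> Y 0" if "X \<in> UNIV \<rightarrow> carrier A" "Y \<in> UNIV \<rightarrow> carrier A" for X Y
    using that by (simp add: series_mult_def Pi_iff)
  have subst: "series_subst A X s 0 = X 0" if "X \<in> UNIV \<rightarrow> carrier A" for X s
    using that by (simp add: series_subst_def Pi_iff smult_one)
  have cl: "X 0 \<in> carrier A" if "X \<in> UNIV \<rightarrow> carrier A" for X :: "nat \<Rightarrow> 'a"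
    using that by auto
  \<comment> \<open>This is the constant term of t^-1 S T: the product of two series without
    constant term has no linear term, so division by t leaves no constant term.\<close>
  have ST: "fps_nth (S_series q * T_series q) (Suc 0) = 0"
    by (simp add: fps_mult_nth S_series_0 T_series_0)
  show ?thesis
    using assms unfolding psi_form_def Let_def
    by (simp add: series_add_def series_diff_def smult mult subst cl ST S_series_0 T_series_0
        smult_zero_left minus_eq)
qed

end

lemma (in assoc_algebra_hom) hom_psi_form:
  assumes "Wm \<in> UNIV \<rightarrow> carrier A" "Wp \<in> UNIV \<rightarrow> carrier A" "G \<in> UNIV \<rightarrow> carrier A" "Gt \<in> UNIV \<rightarrow> carrier A"
  shows "h \<circ> psi_form A q Wm Wp G Gt = psi_form B q (h \<circ> Wm) (h \<circ> Wp) (h \<circ> G) (h \<circ> Gt)"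
  using assms unfolding psi_form_def Let_def
  by (simp add: hom_series_add hom_series_diff hom_series_mult hom_series_smult hom_series_subst)


section \<open>Tensor products\<close>

locale tensor_product = A: assoc_algebra A + B: assoc_algebra B
  for A :: "('f::field, 'a) module" and B :: "('f, 'b) module"
begin

lemma prod_monoid: "monoid (A \<times>\<times> B)"
  by (intro DirProd_monoid A.is_monoid B.is_monoid)

text \<open>The tensor product is itself a presentation: the monoid algebra of pairs modulo
  bilinearity. The results on quotients thus apply to it.\<close>

sublocale tensor: presented_algebra "monoid_algebra (A \<times>\<times> B) :: ('f, 'a \<times> 'b \<Rightarrow>\<^sub>0 'f) module"
    "bilinear_relations A B"
proof (intro presented_algebra.intro presented_algebra_axioms.intro)
  show "assoc_algebra (monoid_algebra (A \<times>\<times> B) :: ('f, 'a \<times> 'b \<Rightarrow>\<^sub>0 'f) module)"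
    by (rule monoid_algebra_assoc_algebra[OF prod_monoid])
  show "bilinear_relations A B \<subseteq> carrier (monoid_algebra (A \<times>\<times> B)) \<times> carrier (monoid_algebra (A \<times>\<times> B))"
    by (auto simp: bilinear_relations_def monoid_algebra_simps dest!: Poly_Mapping.keys_add[THEN subsetD] split: if_splits)
qed

lemma single_mem: "a \<in> carrier A \<Longrightarrow> b \<in> carrier B \<Longrightarrow>
    Poly_Mapping.single (a, b) c \<in> carrier (monoid_algebra (A \<times>\<times> B))"
  by (simp add: monoid_algebra_simps)

lemma pure_tensor_closed:
  "a \<in> carrier A \<Longrightarrow> b \<in> carrier B \<Longrightarrow> pure_tensor A B a b \<in> carrier (tensor_algebra A B)"
  by (simp add: pure_tensor_def tensor_algebra_def tensor.quot_class_simps single_mem)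

lemma pure_tensor_mult:
  assumes "a \<in> carrier A" "b \<in> carrier B" "a' \<in> carrier A" "b' \<in> carrier B"
  shows "pure_tensor A B a b \<otimes>\<^bsub>tensor_algebra A B\<^esub> pure_tensor A B a' b'
    = pure_tensor A B (a \<otimes>\<^bsub>A\<^esub> a') (b \<otimes>\<^bsub>B\<^esub> b')"
  using assms by (simp add: pure_tensor_def tensor_algebra_def tensor.quot_class_simps(2)[symmetric]
      single_mem monoid_algebra_mult_single)

lemma pure_tensor_one: "pure_tensor A B \<one>\<^bsub>A\<^esub> \<one>\<^bsub>B\<^esub> = \<one>\<^bsub>tensor_algebra A B\<^esub>"
  by (simp add: pure_tensor_def tensor_algebra_def tensor.quot_class_simps(4)[symmetric] monoid_algebra_simps)

lemma pure_tensor_add_left: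
  assumes "a \<in> carrier A" "a' \<in> carrier A" "b \<in> carrier B"
  shows "pure_tensor A B (a \<oplus>\<^bsub>A\<^esub> a') b
    = pure_tensor A B a b \<oplus>\<^bsub>tensor_algebra A B\<^esub> pure_tensor A B a' b"
proof -
  have "(Poly_Mapping.single (a \<oplus>\<^bsub>A\<^esub> a', b) 1,
      Poly_Mapping.single (a, b) 1 + Poly_Mapping.single (a', b) 1) \<in> bilinear_relations A B"
    using assms unfolding bilinear_relations_def by blast
  from tensor.quot_class_relation[OF this] show ?thesis
    using assms by (simp add: pure_tensor_def tensor_algebra_def tensor.quot_class_simps(3)[symmetric]
        single_mem monoid_algebra_simps(4))
qed

lemma pure_tensor_smult_left:
  assumes "a \<in> carrier A" "b \<in> carrier B"
  shows "pure_tensor A B (c \<odot>\<^bsub>A\<^esub> a) b = c \<odot>\<^bsub>tensor_algebra A B\<^esub> pure_tensor A B a b"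
proof -
  have "(Poly_Mapping.single (c \<odot>\<^bsub>A\<^esub> a, b) 1, Poly_Mapping.single (a, b) c) \<in> bilinear_relations A B"
    using assms unfolding bilinear_relations_def by blast
  from tensor.quot_class_relation[OF this] show ?thesis
    using assms by (simp add: pure_tensor_def tensor_algebra_def tensor.quot_class_simps(5)[symmetric]
        single_mem monoid_algebra_simps(5) map_mult_single)
qed

lemma tensor_assoc_algebra: "assoc_algebra (tensor_algebra A B)"
  unfolding tensor_algebra_def by (rule tensor.quot_assoc_algebra)

lemma left_embedding_alg_hom: "(\<lambda>a. pure_tensor A B a \<one>\<^bsub>B\<^esub>) \<in> alg_hom A (tensor_algebra A B)"
  by (auto simp: alg_hom_def ring_hom_def pure_tensor_closed pure_tensor_mult pure_tensor_one
      pure_tensor_add_left pure_tensor_smult_left)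

text \<open>Commutation already holds before the quotient is taken: the basis element of
  \<open>(\<one>, b)\<close> commutes with every monomial, hence by additivity with the whole monoid
  algebra, which maps onto the tensor product.\<close>

lemma pure_tensor_center:
  assumes "b \<in> center B"
  shows "pure_tensor A B \<one>\<^bsub>A\<^esub> b \<in> center (tensor_algebra A B)"
proof -
  let ?M = "monoid_algebra (A \<times>\<times> B) :: ('f, 'a \<times> 'b \<Rightarrow>\<^sub>0 'f) module"
  have b: "b \<in> carrier B" "\<And>y. y \<in> carrier B \<Longrightarrow> b \<otimes>\<^bsub>B\<^esub> y = y \<otimes>\<^bsub>B\<^esub> b"
    using assms by (auto simp: center_def)
  have comm: "Poly_Mapping.single (\<one>\<^bsub>A\<^esub>, b) 1 \<otimes>\<^bsub>?M\<^esub> p = p \<otimes>\<^bsub>?M\<^esub> Poly_Mapping.single (\<one>\<^bsub>A\<^esub>, b) 1"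
    if "Poly_Mapping.keys p \<subseteq> carrier (A \<times>\<times> B)" for p
    using that
    by (induction rule: poly_mapping_keys_induct)
      (auto simp: monoid_algebra_mult_zero monoid_algebra_mult_single monoid_algebra_mult_add_l
        monoid_algebra_mult_add_r b(2))
  have "pure_tensor A B \<one>\<^bsub>A\<^esub> b \<otimes>\<^bsub>tensor_algebra A B\<^esub> X = X \<otimes>\<^bsub>tensor_algebra A B\<^esub> pure_tensor A B \<one>\<^bsub>A\<^esub> b"
    if "X \<in> carrier (tensor_algebra A B)" for X
  proof -
    from that obtain p where p: "p \<in> carrier ?M"
        "X = quot_class ?M (bilinear_relations A B) p"
      by (auto simp: tensor_algebra_def tensor.quot_carrier)
    then show ?thesis
      using b comm[of p] by (simp add: pure_tensor_def tensor_algebra_def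
          tensor.quot_class_simps(2)[symmetric] single_mem monoid_algebra_simps(1))
  qed
  then show ?thesis using b by (simp add: center_def pure_tensor_closed)
qed

end


section \<open>The algebras \<open>O\<^sub>q\<close> and \<open>\<O>\<^sub>q\<close>\<close>

text \<open>The carrier of the free algebra is the whole type, so any set of relations is
  admissible.\<close>

lemma free_algebra_presented: "presented_algebra free_algebra R"
proof -
  have "monoid \<lparr>carrier = UNIV, mult = (@), one = []\<rparr>"
    by (rule monoidI) auto
  from monoid_algebra_assoc_algebra[OF this] show ?thesis
    by (intro presented_algebra.intro presented_algebra_axioms.intro)
      (auto simp: free_algebra_def monoid_algebra_simps)
qed

lemma free_algebra_carrier: "x \<in> carrier free_algebra"
  by (simp add: free_algebra_def monoid_algebra_simps)

lemma poly_algebra_assoc_algebra: "assoc_algebra poly_algebra"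
  unfolding poly_algebra_def
  by (rule monoid_algebra_assoc_algebra, rule monoidI) auto

text \<open>The monomials are multisets, whose addition commutes; additivity in both arguments
  extends this to all polynomials.\<close>

lemma poly_algebra_center: "p \<in> center poly_algebra"
proof -
  let ?M = "\<lparr>carrier = UNIV, mult = (+), one = {#}\<rparr> :: nat multiset monoid"
  have "p \<otimes>\<^bsub>monoid_algebra ?M\<^esub> r = r \<otimes>\<^bsub>monoid_algebra ?M\<^esub> p" for r
    using subset_UNIV[of "Poly_Mapping.keys p"]
  proof (induction rule: poly_mapping_keys_induct)
    case (single x a)
    show ?case using subset_UNIV[of "Poly_Mapping.keys r"]
      by (induction rule: poly_mapping_keys_induct)
        (auto simp: monoid_algebra_mult_zero monoid_algebra_mult_single monoid_algebra_mult_add_l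
          monoid_algebra_mult_add_r ac_simps)
  qed (auto simp: monoid_algebra_mult_zero monoid_algebra_mult_add_l monoid_algebra_mult_add_r)
  then show ?thesis
    by (simp add: center_def poly_algebra_def monoid_algebra_simps)
qed

lemma altOq_assoc_algebra: "assoc_algebra (altOq q)"
  unfolding altOq_def by (rule presented_algebra.quot_assoc_algebra[OF free_algebra_presented])

lemma Oq_assoc_algebra: "assoc_algebra (Oq q)"
  unfolding Oq_def by (rule presented_algebra.quot_assoc_algebra[OF free_algebra_presented])

section \<open>Generating series and central elements of \<open>altOq\<close>\<close>

lemma alt_class_closed: "alt_class q x \<in> carrier (altOq q)"
  unfolding alt_class_def altOq_def
  by (rule presented_algebra.quot_class_simps(1)[OF free_algebra_presented free_algebra_carrier])

lemma alt_generators_closed: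
  "altWm q \<in> UNIV \<rightarrow> carrier (altOq q)" "altWp q \<in> UNIV \<rightarrow> carrier (altOq q)"
  "altG q \<in> UNIV \<rightarrow> carrier (altOq q)" "altGt q \<in> UNIV \<rightarrow> carrier (altOq q)"
proof -
  interpret assoc_algebra "altOq q" by (rule altOq_assoc_algebra)
  show "altWm q \<in> UNIV \<rightarrow> carrier (altOq q)" "altWp q \<in> UNIV \<rightarrow> carrier (altOq q)"
    "altG q \<in> UNIV \<rightarrow> carrier (altOq q)" "altGt q \<in> UNIV \<rightarrow> carrier (altOq q)"
    by (auto simp: altWm_def altWp_def altG_def altGt_def alt_class_closed split: nat.split)
qed

lemma Psi_closed: "Psi q \<in> UNIV \<rightarrow> carrier (altOq q)"
  unfolding Psi_eq_psi_form
  by (intro assoc_algebra.psi_form_closed altOq_assoc_algebra alt_generators_closed)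

lemma Zvee_closed: "Zvee q \<in> UNIV \<rightarrow> carrier (altOq q)"
  using Psi_closed[of q] assoc_algebra.smult_closed[OF altOq_assoc_algebra]
  by (auto simp: Zvee_def Pi_iff)

text \<open>The constant term is G_0^2 divided by [2]_q^2 (q^2 - q^-2)^2, and this is 1 because (q -
  q^-1) [2]_q = q^2 - q^-2. The conditions on \<open>q ^ 2\<close> and \<open>q ^ 4\<close> keep the
  denominators nonzero.\<close>

lemma Zvee_0:
  fixes q :: "'f::field"
  assumes "q \<noteq> 0" "q ^ 2 \<noteq> 1" "q ^ 4 \<noteq> 1"
  shows "Zvee q 0 = \<one>\<^bsub>altOq q\<^esub>"
proof -
  interpret assoc_algebra "altOq q" by (rule altOq_assoc_algebra)
  define d e where "d = q - inverse q" and "e = q ^ 2 - inverse q ^ 2"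
  have d: "d \<noteq> 0"
  proof
    assume "d = 0"
    then have "q * q = inverse q * q" by (simp add: d_def)
    then show False using assms by (simp add: power2_eq_square)
  qed
  have e: "e \<noteq> 0"
  proof
    assume "e = 0"
    then have "q ^ 2 * q ^ 2 = inverse q ^ 2 * q ^ 2" by (simp add: e_def)
    also have "\<dots> = 1" using assms(1) by (simp flip: power_mult_distrib)
    finally show False using assms(3) by (simp flip: power_add)
  qed
  have "Psi q 0 = inverse (e ^ 2) \<odot>\<^bsub>altOq q\<^esub> (altG q 0 \<otimes>\<^bsub>altOq q\<^esub> altGt q 0)"
    unfolding Psi_eq_psi_form e_def by (rule psi_form_nth_0[OF alt_generators_closed])
  also have "\<dots> = (inverse (e ^ 2) * (G0_scalar q * G0_scalar q)) \<odot>\<^bsub>altOq q\<^esub> \<one>\<^bsub>altOq q\<^esub>"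
    by (simp add: altG_def altGt_def smult_mult_left smult_mult_right smult_smult)
  finally have "Zvee q 0 =
      (inverse (qint q 2 ^ 2) * (inverse (e ^ 2) * (G0_scalar q * G0_scalar q))) \<odot>\<^bsub>altOq q\<^esub> \<one>\<^bsub>altOq q\<^esub>"
    by (simp add: Zvee_def smult_smult)
  \<comment> \<open>Here \<open>qint q 2\<close> is \<open>e / d\<close> and
    \<open>G0_scalar q\<close> is \<open>- (d * (e / d) ^ 2)\<close>, so all powers of
    \<open>d\<close> and \<open>e\<close> cancel.\<close>
  moreover have "inverse (qint q 2 ^ 2) * (inverse (e ^ 2) * (G0_scalar q * G0_scalar q)) = 1"
    using d e by (simp add: G0_scalar_def qint_def flip: d_def e_def) (simp add: field_simps power2_eq_square)
  ultimately show ?thesis by (simp add: smult_one)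
qed

section \<open>Factorization of the central generating series\<close>

theorem theorem13p14:
  fixes q :: "'f::field"
    and \<gamma> :: "(alt_gen list \<Rightarrow>\<^sub>0 'f) set \<Rightarrow> (onsager_gen list \<Rightarrow>\<^sub>0 'f) set"
    and \<phi> :: "(alt_gen list \<Rightarrow>\<^sub>0 'f) set \<Rightarrow> 'f Oq_poly"
  assumes "q \<noteq> 0"
    and "\<And>n::nat. n \<ge> 1 \<Longrightarrow> q ^ n \<noteq> 1"
    and "is_gamma q \<gamma>"
    and "is_varphi q \<gamma> \<phi>"
  shows "Zvee q =
    series_mult (altOq q)
      (series_subst (altOq q) (Zcal q \<phi>) (S_series q))
      (series_subst (altOq q) (Zcal q \<phi>) (T_series q))"
proof -
  let ?A = "altOq q" and ?P = "Oq_poly q"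
  interpret alt: assoc_algebra ?A by (rule altOq_assoc_algebra)
  interpret tensor_product "Oq q" poly_algebra
    by (intro tensor_product.intro Oq_assoc_algebra poly_algebra_assoc_algebra)
  interpret P: assoc_algebra ?P
    unfolding Oq_poly_def by (rule tensor_assoc_algebra)
  have \<gamma>: "\<gamma> \<in> alg_hom ?A (Oq q)" and \<gamma>_Zvee: "\<And>n. n \<ge> 1 \<Longrightarrow> \<gamma> (Zvee q n) = \<zero>\<^bsub>Oq q\<^esub>"
    using assms(3) by (auto simp: is_gamma_def)
  have \<phi>: "\<phi> \<in> alg_hom ?A ?P" "bij_betw \<phi> (carrier ?A) (carrier ?P)"
    using assms(4) by (auto simp: is_varphi_def alg_iso_def)
  interpret \<phi>: assoc_algebra_hom ?A ?P \<phi>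
    by unfold_locales (rule \<phi>)
  have inj: "x = y" if "\<phi> x = \<phi> y" "x \<in> carrier ?A" "y \<in> carrier ?A" for x y
    using that bij_betw_imp_inj_on[OF \<phi>(2)] by (rule inj_onD[rotated])
  define \<iota> where "\<iota> = (\<lambda>a. tens q a \<one>\<^bsub>poly_algebra\<^esub>)"
  define \<zeta> where "\<zeta> = (\<lambda>n. tens q \<one>\<^bsub>Oq q\<^esub> (zvar n))"
  have \<iota>: "\<iota> \<in> alg_hom (Oq q) ?P"
    unfolding \<iota>_def tens_def Oq_poly_def by (rule left_embedding_alg_hom)
  interpret \<iota>: assoc_algebra_hom "Oq q" ?P \<iota>
    by unfold_locales (rule \<iota>)
  interpret \<iota>\<gamma>: assoc_algebra_hom ?A ?P "\<iota> \<circ> \<gamma>"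
    by unfold_locales (rule alg_hom_comp[OF \<gamma> \<iota>])
  have \<zeta>: "\<zeta> \<in> UNIV \<rightarrow> center ?P"
    unfolding \<zeta>_def tens_def Oq_poly_def by (intro funcsetI pure_tensor_center poly_algebra_center)
  have zvar: "(zvar k :: nat multiset \<Rightarrow>\<^sub>0 'f) \<in> carrier poly_algebra" for k
    by (rule B.centerD(1)[OF poly_algebra_center])

  \<comment> \<open>The given sum attaches the index \<open>k\<close> to \<open>zvar\<close>, so it
    is the product with \<open>\<zeta>\<close> on the left. Centrality moves \<open>\<zeta>\<close>
    to the right, as \<open>psi_form_mult_central\<close> expects.\<close>
  have tens_sum: "(\<Oplus>\<^bsub>?P\<^esub>k \<in> {..n}. tens q (\<gamma> (X (n - k))) (zvar k)) = series_mult ?P (\<iota> \<circ> \<gamma> \<circ> X) \<zeta> n"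
    if X: "X \<in> UNIV \<rightarrow> carrier ?A" for X n
  proof -
    have cl: "\<gamma> (X k) \<in> carrier (Oq q)" for k
      using X alg_homD(1)[OF \<gamma>] by auto
    have "\<zeta> k \<otimes>\<^bsub>?P\<^esub> \<iota> (\<gamma> (X m)) = tens q (\<gamma> (X m)) (zvar k)" for k m
      using cl zvar unfolding \<zeta>_def \<iota>_def tens_def Oq_poly_def by (simp add: pure_tensor_mult)
    then have "(\<Oplus>\<^bsub>?P\<^esub>k \<in> {..n}. tens q (\<gamma> (X (n - k))) (zvar k)) = series_mult ?P \<zeta> (\<iota> \<circ> \<gamma> \<circ> X) n"
      by (simp add: series_mult_def)
    also have "\<dots> = series_mult ?P (\<iota> \<circ> \<gamma> \<circ> X) \<zeta> n"
      using X \<iota>\<gamma>.hom_closed by (subst P.series_mult_central[OF _ \<zeta>]) (auto simp: Pi_iff)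
    finally show ?thesis .
  qed
  \<comment> \<open>In degree 0 the elements are fixed scalars rather than values of
    \<open>\<gamma>\<close>. Since \<open>\<gamma>\<close> preserves scalar multiples of the unit,
    the same formula holds there.\<close>
  have imG: "imG q \<gamma> n = \<gamma> (altG q n)" "imGt q \<gamma> n = \<gamma> (altGt q n)" for n
    by (simp_all add: imG_def imGt_def altG_def altGt_def alg_homD(4,5)[OF \<gamma>] split: nat.split)
  have \<phi>_gens: "\<phi> \<circ> altWm q = series_mult ?P (\<iota> \<circ> \<gamma> \<circ> altWm q) \<zeta>"
      "\<phi> \<circ> altWp q = series_mult ?P (\<iota> \<circ> \<gamma> \<circ> altWp q) \<zeta>"
      "\<phi> \<circ> altG q = series_mult ?P (\<iota> \<circ> \<gamma> \<circ> altG q) \<zeta>"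
      "\<phi> \<circ> altGt q = series_mult ?P (\<iota> \<circ> \<gamma> \<circ> altGt q) \<zeta>"
    using assms(4) by (auto simp: is_varphi_def fun_eq_iff imG tens_sum alt_generators_closed)
  have \<iota>\<gamma>_closed: "\<iota> \<circ> \<gamma> \<circ> X \<in> UNIV \<rightarrow> carrier ?P" if "X \<in> UNIV \<rightarrow> carrier ?A" for X :: "nat \<Rightarrow> _"
    using that \<iota>\<gamma>.hom_closed by (auto simp: Pi_iff)

  let ?ZZ = "series_mult ?P (series_subst ?P \<zeta> (S_series q)) (series_subst ?P \<zeta> (T_series q))"
  have \<zeta>': "\<zeta> \<in> UNIV \<rightarrow> carrier ?P" using \<zeta> by (auto simp: P.centerD Pi_iff)
  have ZZ: "?ZZ \<in> UNIV \<rightarrow> carrier ?P" using \<zeta>' by simp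
  note Psi = Psi_closed[of q]
  \<comment> \<open>\<open>\<phi>\<close> is pushed through the form of \<open>Psi\<close> to the
    four generating series, \<open>\<zeta>\<close> is extracted from them, and what is left is
    recognized as the image of \<open>Psi\<close> under
    \<open>\<iota> \<circ> \<gamma>\<close>.\<close>
  have \<phi>_Psi: "\<phi> \<circ> Psi q = series_mult ?P (\<iota> \<circ> \<gamma> \<circ> Psi q) ?ZZ"
    unfolding Psi_eq_psi_form
    by (simp only: \<phi>.hom_psi_form[OF alt_generators_closed] \<iota>\<gamma>.hom_psi_form[OF alt_generators_closed] \<phi>_gens
        P.psi_form_mult_central[OF \<iota>\<gamma>_closed \<iota>\<gamma>_closed \<iota>\<gamma>_closed \<iota>\<gamma>_closed \<zeta>] alt_generators_closed)
  \<comment> \<open>Degree 0 comes from \<open>Zvee_0\<close>, with \<open>assms(2)\<close> taken at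
    the exponents 2 and 4; in positive degree \<open>\<gamma>\<close> gives zero.\<close>
  have \<iota>\<gamma>_Zvee: "\<iota> \<circ> \<gamma> \<circ> Zvee q = (\<lambda>n. if n = 0 then \<one>\<^bsub>?P\<^esub> else \<zero>\<^bsub>?P\<^esub>)"
    using \<gamma>_Zvee Zvee_0[OF assms(1) assms(2) assms(2)] \<iota>\<gamma>.hom_one
    by (auto simp: fun_eq_iff \<iota>.hom_zero)
  have "\<phi> \<circ> Zvee q = (\<lambda>n. inverse (qint q 2 ^ 2) \<odot>\<^bsub>?P\<^esub> (\<phi> \<circ> Psi q) n)"
    using Psi by (auto simp: Zvee_def fun_eq_iff \<phi>.hom_smult Pi_iff)
  also have "\<dots> = series_mult ?P (\<lambda>n. inverse (qint q 2 ^ 2) \<odot>\<^bsub>?P\<^esub> (\<iota> \<circ> \<gamma> \<circ> Psi q) n) ?ZZ"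
    by (simp only: \<phi>_Psi P.series_mult_smult_left[OF \<iota>\<gamma>_closed[OF Psi] ZZ])
  \<comment> \<open>The normalizing scalar is absorbed into the first factor, turning
    \<open>Psi\<close> back into \<open>Zvee\<close>.\<close>
  also have "(\<lambda>n. inverse (qint q 2 ^ 2) \<odot>\<^bsub>?P\<^esub> (\<iota> \<circ> \<gamma> \<circ> Psi q) n) = \<iota> \<circ> \<gamma> \<circ> Zvee q"
    using Psi \<iota>\<gamma>.hom_smult by (auto simp: Zvee_def fun_eq_iff Pi_iff)
  also have "series_mult ?P (\<iota> \<circ> \<gamma> \<circ> Zvee q) ?ZZ = ?ZZ"
    unfolding \<iota>\<gamma>_Zvee by (rule P.series_mult_one_left[OF ZZ])
  finally have \<phi>_Zvee: "\<phi> \<circ> Zvee q = ?ZZ" .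

  \<comment> \<open>The definite description is justified by bijectivity of \<open>\<phi>\<close>:
    surjectivity provides a preimage of \<open>\<zeta> n\<close>, injectivity makes it unique and
    transfers centrality of \<open>\<zeta> n\<close> back to it.\<close>
  have Zcal: "Zcal q \<phi> n \<in> center ?A \<and> \<phi> (Zcal q \<phi> n) = \<zeta> n" for n
    unfolding Zcal_def fun_cong[OF \<zeta>_def, of n, symmetric]
  proof (rule theI')
    have "\<zeta> n \<in> center ?P" using \<zeta> by auto
    then have "\<zeta> n \<in> carrier ?P" and comm: "\<And>x. x \<in> carrier ?P \<Longrightarrow> \<zeta> n \<otimes>\<^bsub>?P\<^esub> x = x \<otimes>\<^bsub>?P\<^esub> \<zeta> n"
      by (auto simp: center_def)
    then obtain z where z: "z \<in> carrier ?A" "\<phi> z = \<zeta> n"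
      using \<phi>(2) by (metis bij_betw_imp_surj_on imageE)
    have "z \<otimes>\<^bsub>?A\<^esub> x = x \<otimes>\<^bsub>?A\<^esub> z" if x: "x \<in> carrier ?A" for x
      using z x comm[of "\<phi> x"] by (intro inj) (simp_all add: \<phi>.hom_mult)
    then have "z \<in> center ?A \<and> \<phi> z = \<zeta> n" using z by (simp add: center_def)
    then show "\<exists>!z. z \<in> center ?A \<and> \<phi> z = \<zeta> n"
      by (metis (no_types, lifting) inj alt.centerD(1))
  qed
  have Zcal_closed: "Zcal q \<phi> \<in> UNIV \<rightarrow> carrier ?A"
    using Zcal by (auto simp: alt.centerD)
  have "\<phi> \<circ> Zcal q \<phi> = \<zeta>" using Zcal by auto
  \<comment> \<open>The right-hand side also maps to \<open>?ZZ\<close>, since \<open>\<phi>\<close>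
    commutes with products and substitutions and sends \<open>Zcal\<close> to
    \<open>\<zeta>\<close>. Injectivity on the carrier then yields equality in each degree.\<close>
  then have "\<phi> \<circ> Zvee q = \<phi> \<circ> series_mult ?A (series_subst ?A (Zcal q \<phi>) (S_series q))
      (series_subst ?A (Zcal q \<phi>) (T_series q))"
    using Zcal_closed by (simp add: \<phi>_Zvee \<phi>.hom_series_mult \<phi>.hom_series_subst)
  then have "\<phi> (Zvee q n) = \<phi> (series_mult ?A (series_subst ?A (Zcal q \<phi>) (S_series q))
      (series_subst ?A (Zcal q \<phi>) (T_series q)) n)" for n
    by (metis comp_apply)
  moreover have "series_mult ?A (series_subst ?A (Zcal q \<phi>) (S_series q))
      (series_subst ?A (Zcal q \<phi>) (T_series q)) \<in> UNIV \<rightarrow> carrier ?A"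
    using Zcal_closed by simp
  ultimately show ?thesis
    using Zvee_closed[of q] by (intro ext inj) auto
qed

end
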